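(* There exists a constant $\mathcal{C}$ such that the following holds for all sufficiently large $n$. If $v_1<v_2<\dots<v_n$ are positive integers with $n<v_n\le 2n-\exp(\mathcal{C}\cdot(\log\log n)^2)$, then there exists $t\in\mathbb{R}$ such that $$\frac{1}{n+1}<\{v_i t\}<\frac{n}{n+1}\quad\text{for all } i=1,\dots,n.$$
   Context: For real $x$, $\{x\}=x-\lfloor x\rfloor$ denotes the fractional part of $x$. (An instance $v_1<\dots<v_n$ satisfying the displayed strict condition is called a loose instance of the lonely runner conjecture.) *)

theory Defs
  imports Complex_Main
begin

end

theory Submission
  imports Defs "HOL-Real_Asymp.Real_Asymp" "HOL-Number_Theory.Number_Theory"
begin

text \<open>
  Let \<open>V\<close> be the set of speeds, \<open>N\<close> its maximum, \<open>L = (2 n - N) div 2\<close> and \<open>h = N div 2\<close>, and suppose that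
  the instance is not loose. Exactly \<open>N - n\<close> numbers in \<open>[1, N]\<close> are missing from \<open>V\<close>.
  The times \<open>1 / q\<close> show that a number in \<open>(h, n]\<close> cannot be missing, and small perturbations of the times
  \<open>s / q\<close> show that a number which is at most slightly larger than \<open>L\<close> cannot be missing. So the missing
  numbers lie in \<open>(L, h]\<close> or in \<open>(n, N)\<close>, and \<open>h - L = N - n\<close>.
  If \<open>x\<close> and \<open>y\<close> are coprime and missing and \<open>N < x + y \<le> 2 n + 1\<close>, a time \<open>s / (x + y)\<close> works.
  Cut \<open>(L, h]\<close> from above and \<open>(n, N]\<close> from below into blocks of length \<open>2 m\<close>; the sums of elements of
  corresponding blocks are in the admissible range. Two intervals of length
  \<open>2 m \<ge> exp (C (log log n)^2)\<close> contain at most \<open>2 m\<close> elements in total if no pair is coprime, so that each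
  pair of blocks contains at most \<open>2 m\<close> missing numbers. As \<open>N\<close> itself is not missing, the total is less
  than \<open>N - n\<close>, a contradiction.

  The statement on blocks splits into even numbers of one interval against odd numbers of the other.
  There it follows from Brun's pure sieve, whose error term is the origin of \<open>exp (C (log log n)^2)\<close>,
  and from a third moment bound which says that few numbers have a small totient ratio.
\<close>

section \<open>A sieve on arithmetic progressions of step two\<close>

text \<open>Splitting by membership of \<open>p\<close> gives the recursion behind both the
  Bonferroni inequality and the count of small subsets.\<close>

lemma sum_small_subsets_insert:
  fixes f :: "'a set \<Rightarrow> real"
  assumes "finite B" "p \<notin> B"
  shows "(\<Sum>D | D \<subseteq> insert p B \<and> card D \<le> k. f D) =
    (\<Sum>D | D \<subseteq> B \<and> card D \<le> k. f D) + (\<Sum>D | D \<subseteq> B \<and> card D < k. f (insert p D))"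
proof -
  let ?U = "{D. D \<subseteq> B \<and> card D \<le> k}" and ?V = "{D. D \<subseteq> B \<and> card D < k}"
  have card_ins: "card (insert p D) = Suc (card D)" if "D \<subseteq> B" for D
    using assms that by (metis card_insert_disjoint finite_subset subsetD)
  have eq: "{D. D \<subseteq> insert p B \<and> card D \<le> k} = ?U \<union> insert p ` ?V"
  proof (intro equalityI subsetI)
    fix D assume D: "D \<in> {D. D \<subseteq> insert p B \<and> card D \<le> k}"
    show "D \<in> ?U \<union> insert p ` ?V"
    proof (cases "p \<in> D")
      case True
      have "D - {p} \<subseteq> B" using D by auto
      moreover have "insert p (D - {p}) = D" using True by auto
      ultimately show ?thesis using D card_ins[of "D - {p}"] by (intro UnI2 image_eqI[of _ _ "D - {p}"]) auto
    next
      case False then show ?thesis using D by auto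
    qed
  next
    fix D assume "D \<in> ?U \<union> insert p ` ?V"
    then show "D \<in> {D. D \<subseteq> insert p B \<and> card D \<le> k}" using card_ins by auto
  qed
  have fin: "finite ?U" "finite ?V" using assms by auto
  have inj: "inj_on (insert p) ?V" using assms by (intro inj_onI) (metis insert_ident mem_Collect_eq subsetD)
  show ?thesis unfolding eq
    using assms fin inj by (subst sum.union_disjoint) (auto simp: sum.reindex)
qed

text \<open>Pairing \<open>D\<close> with \<open>insert p D\<close> cancels all but the subsets of
  size exactly \<open>k\<close> avoiding \<open>p\<close>; these have sign -1 because
  \<open>k\<close> is odd.\<close>

lemma bonferroni_odd:
  assumes "finite A" "odd k"
  shows "(\<Sum>D | D \<subseteq> A \<and> card D \<le> k. (- 1 :: real) ^ card D) \<le> (if A = {} then 1 else 0)"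
proof (cases "A = {}")
  case True
  then have "{D. D \<subseteq> A \<and> card D \<le> k} = {{}}" by auto
  then show ?thesis using True by simp
next
  case False
  then obtain p B where A: "A = insert p B" "p \<notin> B" by (metis Set.set_insert ex_in_conv)
  then have fB: "finite B" using assms by auto
  have "(\<Sum>D | D \<subseteq> B \<and> card D < k. (- 1 :: real) ^ card (insert p D)) =
      (\<Sum>D | D \<subseteq> B \<and> card D < k. - ((- 1 :: real) ^ card D))"
    using A(2) fB by (intro sum.cong refl) (subst card_insert_disjoint; auto intro: finite_subset)
  moreover have "{D. D \<subseteq> B \<and> card D \<le> k} = {D. D \<subseteq> B \<and> card D < k} \<union> {D. D \<subseteq> B \<and> card D = k}"
    by auto
  then have "(\<Sum>D | D \<subseteq> B \<and> card D \<le> k. (- 1 :: real) ^ card D) =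
      (\<Sum>D | D \<subseteq> B \<and> card D < k. (- 1) ^ card D) + (\<Sum>D | D \<subseteq> B \<and> card D = k. (- 1) ^ card D)"
    using fB by (simp only:) (subst sum.union_disjoint; auto)
  moreover have "(\<Sum>D | D \<subseteq> B \<and> card D = k. (- 1 :: real) ^ card D) = (\<Sum>D | D \<subseteq> B \<and> card D = k. - 1)"
    using assms(2) by (intro sum.cong) auto
  moreover have "(\<Sum>D | D \<subseteq> B \<and> card D = k. - 1 :: real) \<le> 0" by (intro sum_nonpos) auto
  ultimately have "(\<Sum>D | D \<subseteq> insert p B \<and> card D \<le> k. (- 1 :: real) ^ card D) \<le> 0"
    using sum_small_subsets_insert[OF fB A(2), where f = "\<lambda>D. (- 1 :: real) ^ card D" and k = k]
    by (simp add: sum_negf)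
  then show ?thesis using False A by simp
qed

text \<open>Bounds the number of rounding errors, one per divisor, in the truncated sieve.\<close>

lemma card_small_subsets:
  assumes "finite B"
  shows "real (card {D. D \<subseteq> B \<and> card D \<le> k}) \<le> (real (card B) + 1) ^ k"
  using assms
proof (induction B arbitrary: k rule: finite_induct)
  case empty
  have "{D::'a set. D \<subseteq> {} \<and> card D \<le> k} = {{}}" by auto
  then show ?case by simp
next
  case (insert p B)
  have *: "real (card {D. D \<subseteq> insert p B \<and> card D \<le> k}) =
     real (card {D. D \<subseteq> B \<and> card D \<le> k}) + real (card {D. D \<subseteq> B \<and> card D < k})"
    using sum_small_subsets_insert[OF insert(1,2), where f = "\<lambda>_. 1" and k = k] by simp
  show ?case
  proof (cases k)
    case 0
    then show ?thesis using * insert.IH[of 0] by simp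
  next
    case (Suc j)
    let ?w = "real (card B)"
    have "real (card {D. D \<subseteq> insert p B \<and> card D \<le> k}) \<le> (?w + 1) ^ Suc j + (?w + 1) ^ j"
      using * insert.IH[of k] insert.IH[of j] Suc by (simp add: less_Suc_eq_le)
    also have "\<dots> = (?w + 1) ^ j * (?w + 2)" by (simp add: algebra_simps)
    also have "\<dots> \<le> (?w + 2) ^ j * (?w + 2)" by (intro mult_right_mono power_mono) auto
    finally show ?thesis using Suc insert by (simp add: algebra_simps)
  qed
qed

text \<open>Since 2 is invertible modulo the odd \<open>d\<close>, the divisibility condition fixes
  \<open>i\<close> modulo \<open>d\<close>.\<close>

lemma card_AP_dvd:
  fixes a m d :: nat
  assumes "odd d"
  shows "real m / d - 1 \<le> card {i\<in>{..<m}. d dvd a + 2 * i}"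
    and "card {i\<in>{..<m}. d dvd a + 2 * i} \<le> real m / d + 1"
proof -
  have d0: "d > 0" using assms by (cases d) auto
  have cop: "coprime 2 d" using assms by simp
  obtain x where x: "[2 * x = 1] (mod d)" using cong_solve_coprime_nat[OF cop] by auto
  \<comment> \<open>\<open>d - a mod d\<close> represents \<open>-a\<close> and \<open>x\<close>
    inverts 2, so \<open>r\<close> is the root of \<open>a + 2 r = 0\<close> modulo
    \<open>d\<close>.\<close>
  define r where "r = ((d - a mod d) * x) mod d"
  have r: "r < d" using d0 r_def by simp
  have "[2 * r = 2 * ((d - a mod d) * x)] (mod d)"
    unfolding r_def cong_def by (rule mod_mult_right_eq)
  also have "2 * ((d - a mod d) * x) = (d - a mod d) * (2 * x)" by (rule mult.left_commute)
  also have "[(d - a mod d) * (2 * x) = (d - a mod d) * 1] (mod d)" by (intro cong_mult x cong_refl)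
  finally have "[a mod d + 2 * r = a mod d + (d - a mod d)] (mod d)" by (intro cong_add) auto
  then have ar: "[a + 2 * r = 0] (mod d)" using d0
    by (simp add: cong_def mod_add_left_eq)
  have iff: "d dvd a + 2 * i \<longleftrightarrow> i mod d = r" for i
  proof -
    have "d dvd a + 2 * i \<longleftrightarrow> [a + 2 * i = a + 2 * r] (mod d)"
      using ar by (metis cong_0_iff cong_sym cong_trans)
    also have "\<dots> \<longleftrightarrow> [i = r] (mod d)" using cop
      by (simp add: cong_add_lcancel_nat cong_mult_lcancel_nat)
    finally show ?thesis using r by (simp add: cong_def)
  qed
  define S where "S = {i\<in>{..<m}. d dvd a + 2 * i}"
  have inj: "inj_on (\<lambda>i. i div d) S" unfolding S_def iff
    by (intro inj_onI) (metis (mono_tags, lifting) div_mult_mod_eq mem_Collect_eq)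
  have up: "(\<lambda>i. i div d) ` S \<subseteq> {..m div d}" unfolding S_def by (auto simp: div_le_mono)
  have lo: "{..<m div d} \<subseteq> (\<lambda>i. i div d) ` S"
  proof
    fix j assume "j \<in> {..<m div d}"
    then have "Suc j * d \<le> m" by (metis Suc_leI d0 lessThan_iff less_eq_div_iff_mult_less_eq)
    then have "j * d + r < m" using r by simp
    then have "j * d + r \<in> S" unfolding S_def iff using r by simp
    moreover have "(j * d + r) div d = j" using r by simp
    ultimately show "j \<in> (\<lambda>i. i div d) ` S" by force
  qed
  have "card S \<le> m div d + 1" using card_mono[OF _ up] card_image[OF inj] by simp
  moreover have "real (m div d) \<le> real m / d" by (rule of_nat_div_le_of_nat)
  ultimately show "card {i\<in>{..<m}. d dvd a + 2 * i} \<le> real m / d + 1" unfolding S_def[symmetric] by linarith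
  have "m div d \<le> card S" using card_mono[OF _ lo] card_image[OF inj] S_def by simp
  moreover have "real m / d - 1 \<le> real (m div d)" using of_nat_of_nat_div_aux[of m d, where ?'a = real] d0
    by (simp add: divide_le_eq order_less_imp_le)
  ultimately show "real m / d - 1 \<le> card {i\<in>{..<m}. d dvd a + 2 * i}" unfolding S_def[symmetric] by linarith
qed

section \<open>Products over finite sets of primes\<close>

lemma prod_primes_dvd_iff:
  fixes D :: "nat set"
  assumes "finite D" "\<And>p. p \<in> D \<Longrightarrow> prime p"
  shows "\<Prod>D dvd x \<longleftrightarrow> (\<forall>p\<in>D. p dvd x)"
  using assms
proof (induction D rule: finite_induct)
  case (insert p D)
  have "coprime p (\<Prod>D)"
    using insert by (intro prod_coprime_right) (metis insertCI primes_coprime)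
  then show ?case using insert by (auto intro: divides_mult dvd_mult_left dvd_mult_right)
qed simp

text \<open>The largest of \<open>w + 1\<close> distinct integers that are at least 2 is at least
  \<open>w + 2\<close>. Removing it and inducting compares the set with an initial segment, where
  the products of interest telescope.\<close>

lemma prod_le_prod_initial_segment:
  fixes Q :: "nat set" and f :: "nat \<Rightarrow> real"
  assumes "finite Q" "\<And>p. p \<in> Q \<Longrightarrow> p \<ge> 2"
    and f: "\<And>p q. 2 \<le> p \<Longrightarrow> p \<le> q \<Longrightarrow> f q \<le> f p" "\<And>p. p \<ge> 2 \<Longrightarrow> 0 \<le> f p"
  shows "(\<Prod>p\<in>Q. f p) \<le> (\<Prod>i<card Q. f (i + 2))"
  using assms(1,2)
proof (induction "card Q" arbitrary: Q)
  case 0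
  then show ?case by simp
next
  case (Suc w)
  define M where "M = Max Q"
  have ne: "Q \<noteq> {}" using Suc by auto
  have MQ: "M \<in> Q" using ne Suc by (simp add: M_def)
  have "Q \<subseteq> {2..M}" using Suc by (auto simp: M_def)
  then have "card Q \<le> M - 1" using card_mono[of "{2..M}" Q] by simp
  then have M: "w + 2 \<le> M" using Suc by simp
  have w: "w = card (Q - {M})" using Suc MQ by simp
  have "(\<Prod>p\<in>Q. f p) = f M * (\<Prod>p\<in>Q - {M}. f p)" using Suc MQ by (simp add: prod.remove)
  also have "\<dots> \<le> f (w + 2) * (\<Prod>i<w. f (i + 2))"
    using Suc.hyps(1)[OF w] Suc.prems w M
    by (intro mult_mono f) (auto intro!: prod_nonneg f)
  also have "\<dots> = (\<Prod>i<Suc w. f (i + 2))" by simp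
  finally show ?case using Suc by simp
qed

lemma prod_one_minus_inverse_ge:
  fixes Q :: "nat set"
  assumes "finite Q" "\<And>p. p \<in> Q \<Longrightarrow> p \<ge> 2"
  shows "(\<Prod>p\<in>Q. 1 - 1 / real p) \<ge> 1 / (card Q + 1)"
proof -
  have pos: "0 < 1 - 1 / real p" if "p \<ge> 2" for p using that by simp
  \<comment> \<open>The factors \<open>1 - 1 / p\<close> increase with \<open>p\<close>, so the
    comparison is applied to their inverses.\<close>
  have "(\<Prod>p\<in>Q. inverse (1 - 1 / real p)) \<le> (\<Prod>i<card Q. inverse (1 - 1 / real (i + 2)))"
    using assms by (intro prod_le_prod_initial_segment) (auto intro!: le_imp_inverse_le frac_le)
  also have "\<dots> = real (card Q) + 1"
  proof -
    have "(\<Prod>i<w. inverse (1 - 1 / real (i + 2))) = real w + 1" for w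
      by (induction w) (simp_all add: field_simps)
    then show ?thesis .
  qed
  finally have "inverse (\<Prod>p\<in>Q. (1 - 1 / real p)) \<le> real (card Q) + 1"
    using prod_inversef[of "\<lambda>p. 1 - 1 / real p" Q] by (simp add: comp_def)
  moreover have "(\<Prod>p\<in>Q. 1 - 1 / real p) > 0" using assms by (intro prod_pos pos) auto
  ultimately show ?thesis by (simp add: field_simps)
qed

lemma prod_one_plus_two_inverse_le:
  fixes Q :: "nat set"
  assumes "finite Q" "\<And>p. p \<in> Q \<Longrightarrow> p \<ge> 2"
  shows "(\<Prod>p\<in>Q. 1 + 2 / real p) \<le> (real (card Q) + 2) ^ 2"
proof -
  have "(\<Prod>p\<in>Q. 1 + 2 / real p) \<le> (\<Prod>i<card Q. 1 + 2 / real (i + 2))"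
    using assms by (intro prod_le_prod_initial_segment) (auto intro!: frac_le)
  also have "\<dots> \<le> (real (card Q) + 2) ^ 2"
  proof -
    have "(\<Prod>i<w. 1 + 2 / real (i + 2)) = (real w + 2) * (real w + 3) / 6" for w
    proof (induction w)
      case (Suc w)
      then show ?case by (simp add: field_simps)
    qed simp
    moreover have "(real w + 2) * (real w + 3) / 6 \<le> (real w + 2) ^ 2" for w
      by (simp add: power2_eq_square field_simps)
    ultimately show ?thesis by metis
  qed
  finally show ?thesis .
qed

lemma prod_one_add:
  fixes f :: "'a \<Rightarrow> real"
  assumes "finite A"
  shows "(\<Prod>x\<in>A. 1 + f x) = (\<Sum>D\<in>Pow A. \<Prod>x\<in>D. f x)"
  using prod_add[OF assms, of f "\<lambda>_. 1"] by (simp add: add.commute)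

text \<open>
  Brun's pure sieve: Bonferroni truncation at level \<open>k\<close>, the tail being bounded by Rankin's trick with
  weight 2. No information on the distribution of primes enters, because the telescoping products
  only use that the elements of \<open>Q\<close> are distinct.
\<close>
lemma brun_sieve_AP:
  fixes a m k :: nat and Q :: "nat set"
  assumes Q: "finite Q" "\<And>p. p \<in> Q \<Longrightarrow> prime p \<and> odd p" and k: "odd k"
  shows "m * (\<Prod>p\<in>Q. 1 - 1 / real p) - m * (real (card Q) + 2)^2 / 2 ^ k - (real (card Q) + 1) ^ k
    \<le> card {i\<in>{..<m}. \<forall>p\<in>Q. \<not> p dvd a + 2 * i}"
proof -
  define P where "P = {D. D \<subseteq> Q \<and> card D \<le> k}"
  define c where "c D = real (card {i\<in>{..<m}. \<Prod>D dvd a + 2 * i})" for D :: "nat set"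
  have finP: "finite P" unfolding P_def using Q by auto
  have dvd: "\<Prod>D dvd x \<longleftrightarrow> D \<subseteq> {p\<in>Q. p dvd x}" if "D \<subseteq> Q" for D x
    using prod_primes_dvd_iff[of D x] that Q finite_subset[of D Q] by auto
  have oddD: "odd (\<Prod>D)" if "D \<subseteq> Q" for D
    using that Q prime_dvd_prod_iff[of D 2 "\<lambda>x. x"] finite_subset[of D Q] by auto
  have main: "real (card {i\<in>{..<m}. \<forall>p\<in>Q. \<not> p dvd a + 2 * i}) \<ge> (\<Sum>D\<in>P. (-1) ^ card D * c D)"
  proof -
    have "(\<Sum>D\<in>P. (-1) ^ card D * c D)
      = (\<Sum>D\<in>P. \<Sum>i<m. (-1) ^ card D * of_bool (\<Prod>D dvd a + 2 * i))"
      unfolding c_def by (simp add: sum_distrib_left[symmetric] sum_of_bool_eq Int_def)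
    also have "\<dots> = (\<Sum>i<m. \<Sum>D\<in>P. (-1) ^ card D * of_bool (\<Prod>D dvd a + 2 * i))"
      by (rule sum.swap)
    also have "\<dots> \<le> (\<Sum>i<m. of_bool (\<forall>p\<in>Q. \<not> p dvd a + 2 * i))"
    proof (rule sum_mono)
      fix i
      \<comment> \<open>The inner sum becomes the truncated alternating sum over subsets of
        \<open>R\<close>, the sifting primes dividing this term.\<close>
      define R where "R = {p\<in>Q. p dvd a + 2 * i}"
      have "(\<Sum>D\<in>P. (-1) ^ card D * of_bool (\<Prod>D dvd a + 2 * i)) =
         (\<Sum>D\<in>P. if D \<subseteq> R then (-1) ^ card D else (0::real))"
        unfolding P_def R_def by (intro sum.cong refl) (auto simp: dvd)
      also have "\<dots> = (\<Sum>D | D \<subseteq> R \<and> card D \<le> k. (-1) ^ card D)"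
        using finP by (subst sum.inter_filter[symmetric]) (auto simp: P_def R_def intro!: sum.cong)
      also have "\<dots> \<le> (if R = {} then 1 else 0)"
        using Q k by (intro bonferroni_odd) (auto simp: R_def)
      also have "\<dots> = of_bool (\<forall>p\<in>Q. \<not> p dvd a + 2 * i)" by (auto simp: R_def)
      finally show "(\<Sum>D\<in>P. (-1) ^ card D * of_bool (\<Prod>D dvd a + 2 * i))
         \<le> (of_bool (\<forall>p\<in>Q. \<not> p dvd a + 2 * i) :: real)" .
    qed
    also have "\<dots> = card {i\<in>{..<m}. \<forall>p\<in>Q. \<not> p dvd a + 2 * i}"
      by (simp add: sum_of_bool_eq Int_def)
    finally show ?thesis .
  qed
  \<comment> \<open>Replacing each count by its expected value costs at most 1 for each of the
    \<open>card P\<close> divisors.\<close>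
  have "(\<Sum>D\<in>P. (-1) ^ card D * c D) \<ge> (\<Sum>D\<in>P. (-1) ^ card D * (m / real (\<Prod>D)) - 1)"
  proof (rule sum_mono)
    fix D assume "D \<in> P"
    then have "odd (\<Prod>D)" using oddD by (auto simp: P_def)
    from card_AP_dvd[OF this, of m a] have "\<bar>c D - m / real (\<Prod>D)\<bar> \<le> 1"
      unfolding c_def by linarith
    moreover have "\<bar>(-1) ^ card D * c D - (-1) ^ card D * (m / real (\<Prod>D))\<bar> = \<bar>c D - m / real (\<Prod>D)\<bar>"
      by (simp only: right_diff_distrib[symmetric] abs_mult power_abs) simp
    ultimately show "(-1) ^ card D * (m / real (\<Prod>D)) - 1 \<le> (-1) ^ card D * c D" by linarith
  qed
  moreover have "(\<Sum>D\<in>P. (-1) ^ card D * (m / real (\<Prod>D)) - 1) =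
     m * (\<Sum>D\<in>P. (-1) ^ card D / real (\<Prod>D)) - card P"
    by (simp add: sum_subtractf sum_distrib_left mult.commute)
  moreover have "(\<Sum>D\<in>P. (-1) ^ card D / real (\<Prod>D)) \<ge>
      (\<Prod>p\<in>Q. 1 - 1 / real p) - (real (card Q) + 2)^2 / 2 ^ k"
  proof -
    have "(\<Prod>p\<in>Q. 1 - 1 / real p) = (\<Sum>D\<in>Pow Q. (-1) ^ card D / real (\<Prod>D))"
    proof -
      have "(\<Prod>p\<in>D. - 1 / real p) = (- 1) ^ card D / real (\<Prod>D)" for D
        by (simp only: prod_dividef prod_constant of_nat_prod)
      then show ?thesis
        using prod_one_add[OF Q(1), of "\<lambda>p. - 1 / real p"] by simp
    qed
    also have "\<dots> = (\<Sum>D\<in>P. (-1) ^ card D / real (\<Prod>D)) + (\<Sum>D\<in>Pow Q - P. (-1) ^ card D / real (\<Prod>D))"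
      using Q(1) by (subst sum.subset_diff[of P]) (auto simp: P_def)
    finally have 1: "(\<Prod>p\<in>Q. 1 - 1 / real p) = \<dots>" .
    have pos: "real (\<Prod>D) > 0" if "D \<subseteq> Q" for D
      unfolding of_nat_0_less_iff using prod_pos[of D "\<lambda>p. p"] that Q prime_gt_0_nat by (meson subsetD)
    have "(\<Sum>D\<in>Pow Q - P. (-1) ^ card D / real (\<Prod>D)) \<le> (\<Sum>D\<in>Pow Q - P. 2 ^ card D / real (\<Prod>D) / 2 ^ k)"
    proof (rule sum_mono)
      fix D assume D: "D \<in> Pow Q - P"
      then have "k \<le> card D" by (auto simp: P_def)
      then have "(2::real) ^ k \<le> 2 ^ card D" by simp
      have "(-1::real) ^ card D \<le> 1" by (cases "even (card D)") auto
      also have "\<dots> \<le> 2 ^ card D / 2 ^ k" using \<open>(2::real) ^ k \<le> 2 ^ card D\<close> by simp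
      finally have "(-1::real) ^ card D / real (\<Prod>D) \<le> 2 ^ card D / 2 ^ k / real (\<Prod>D)"
        using pos[of D] D by (intro divide_right_mono) auto
      then show "(-1::real) ^ card D / real (\<Prod>D) \<le> 2 ^ card D / real (\<Prod>D) / 2 ^ k"
        by (simp add: mult.commute)
    qed
    also have "\<dots> \<le> (\<Sum>D\<in>Pow Q. 2 ^ card D / real (\<Prod>D) / 2 ^ k)"
      using Q(1) by (intro sum_mono2) (auto intro!: divide_nonneg_nonneg prod_nonneg mult_nonneg_nonneg)
    also have "\<dots> = (\<Prod>p\<in>Q. 1 + 2 / real p) / 2 ^ k"
      using prod_one_add[OF Q(1), of "\<lambda>p. 2 / real p"]
      by (simp add: prod_dividef sum_divide_distrib)
    also have "\<dots> \<le> (real (card Q) + 2)^2 / 2 ^ k"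
      using Q by (intro divide_right_mono prod_one_plus_two_inverse_le) (auto dest: prime_ge_2_nat)
    finally show ?thesis using 1 by linarith
  qed
  then have "m * (\<Sum>D\<in>P. (-1) ^ card D / real (\<Prod>D)) \<ge>
     m * ((\<Prod>p\<in>Q. 1 - 1 / real p) - (real (card Q) + 2)^2 / 2 ^ k)"
    by (intro mult_left_mono) auto
  moreover have "real (card P) \<le> (real (card Q) + 1) ^ k"
    unfolding P_def using card_small_subsets[OF Q(1)] .
  ultimately show ?thesis using main by (simp add: right_diff_distrib)
qed

section \<open>Odd prime factors and the totient ratio\<close>

definition odd_primes_of :: "nat \<Rightarrow> nat set" where
  "odd_primes_of y = {p. prime p \<and> odd p \<and> p dvd y}"

text \<open>For positive \<open>y\<close> this is \<open>phi(y) / y\<close> without its factor at 2,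
  a prime left out because the progressions have step 2.\<close>

definition odd_totient_ratio :: "nat \<Rightarrow> real" where
  "odd_totient_ratio y = (\<Prod>p\<in>odd_primes_of y. 1 - 1 / real p)"

lemma finite_odd_primes_of: "y > 0 \<Longrightarrow> finite (odd_primes_of y)"
  unfolding odd_primes_of_def by (rule finite_subset[of _ "{..y}"]) (auto dest: dvd_imp_le)

text \<open>The product of \<open>Q\<close> divides \<open>y\<close> and is at least
  \<open>2 ^ card Q\<close>.\<close>

lemma card_primes_dvd_le:
  fixes Q :: "nat set"
  assumes "0 < y" "y \<le> 2 ^ W" "finite Q" "\<And>p. p \<in> Q \<Longrightarrow> prime p \<and> p dvd y"
  shows "card Q \<le> W"
proof -
  have "\<Prod>Q dvd y" using prod_primes_dvd_iff assms by blast
  then have "\<Prod>Q \<le> y" using assms by (simp add: dvd_imp_le)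
  moreover have "2 ^ card Q \<le> \<Prod>Q"
    using prod_mono[of Q "\<lambda>_. 2" "\<lambda>p. p"] assms by (auto dest: prime_ge_2_nat)
  ultimately have "(2::nat) ^ card Q \<le> 2 ^ W" using assms by linarith
  then show ?thesis by simp
qed

lemma card_odd_primes_of: "0 < y \<Longrightarrow> y \<le> 2 ^ W \<Longrightarrow> card (odd_primes_of y) \<le> W"
  by (rule card_primes_dvd_le[of y W "odd_primes_of y"])
    (simp_all add: finite_odd_primes_of, simp add: odd_primes_of_def)

lemma odd_totient_ratio_ge:
  assumes "y > 0"
  shows "odd_totient_ratio y \<ge> 1 / (card (odd_primes_of y) + 1)"
  unfolding odd_totient_ratio_def using assms
  by (intro prod_one_minus_inverse_ge finite_odd_primes_of) (auto simp: odd_primes_of_def dest: prime_ge_2_nat)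

lemma odd_totient_ratio_pos:
  assumes "y > 0" shows "odd_totient_ratio y > 0"
proof -
  have "0 < 1 / real (card (odd_primes_of y) + 1)" by simp
  then show ?thesis using odd_totient_ratio_ge[OF assms] by linarith
qed

text \<open>The main term is at least \<open>m / (W + 2)\<close>. The hypothesis on \<open>k\<close>
  makes the truncation error, and that on \<open>m\<close> the rounding error, at most 1/200 of it;
  hence the factor 0.99.\<close>

lemma card_coprime_AP_ge:
  fixes a m k W y :: nat
  assumes "0 < y" "y \<le> 2 ^ W" "odd k"
    and k: "200 * (W + 2) ^ 3 \<le> 2 ^ k" and m: "200 * (W + 2) ^ (k + 1) \<le> m"
  shows "0.99 * m * odd_totient_ratio y \<le> card {i\<in>{..<m}. \<forall>p\<in>odd_primes_of y. \<not> p dvd a + 2 * i}"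
proof -
  let ?Q = "odd_primes_of y" and ?r = "odd_totient_ratio y"
  let ?w = "real (card ?Q)"
  define x where "x = m * ?r"
  define e where "e = m * (1 / (200 * (real W + 2)))"
  define e1 where "e1 = m * (?w + 2)^2 / 2 ^ k"
  define e2 where "e2 = (?w + 1) ^ k"
  have w: "?w \<le> W" using card_odd_primes_of assms by simp
  have 1: "x - e1 - e2 \<le> card {i\<in>{..<m}. \<forall>p\<in>odd_primes_of y. \<not> p dvd a + 2 * i}"
    unfolding x_def odd_totient_ratio_def e1_def e2_def using assms
    by (intro brun_sieve_AP finite_odd_primes_of) (auto simp: odd_primes_of_def)
  have k': "200 * (real W + 2) ^ 3 \<le> 2 ^ k"
  proof -
    have "real (200 * (W + 2) ^ 3) \<le> real (2 ^ k)" using k by (simp only: of_nat_le_iff)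
    then show ?thesis by (simp add: add.commute)
  qed
  have m': "200 * (real W + 2) ^ (k + 1) \<le> m"
  proof -
    have "real (200 * (W + 2) ^ (k + 1)) \<le> real m" using m by (simp only: of_nat_le_iff)
    then show ?thesis by (simp only: of_nat_mult of_nat_power of_nat_add of_nat_numeral)
  qed
  have "(?w + 2)^2 / 2 ^ k \<le> (real W + 2)^2 / (200 * (real W + 2) ^ 3)"
    using w k' by (intro frac_le power_mono) auto
  also have "\<dots> = 1 / (200 * (real W + 2))" by (simp add: power2_eq_square power3_eq_cube)
  finally have "m * ((?w + 2)^2 / 2 ^ k) \<le> m * (1 / (200 * (real W + 2)))"
    by (intro mult_left_mono) auto
  then have 2: "e1 \<le> e" by (simp add: e1_def e_def)
  have "(?w + 1) ^ k \<le> (real W + 2) ^ k" using w by (intro power_mono) auto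
  also have "\<dots> \<le> m * (1 / (200 * (real W + 2)))" using m' by (simp add: field_simps)
  finally have 3: "e2 \<le> e" by (simp only: e2_def e_def)
  have "1 / (real W + 2) \<le> 1 / (?w + 1)" using w by (intro frac_le) auto
  also have "\<dots> \<le> ?r" using odd_totient_ratio_ge[OF assms(1)] by (simp add: add.commute)
  finally have "m * (1 / (real W + 2)) \<le> m * ?r" by (intro mult_left_mono) auto
  then have "e \<le> m * ?r / 200" by (simp add: e_def field_simps)
  then have 4: "e \<le> x / 200" by (simp only: x_def)
  have "0.99 * m * ?r = x - 2 * (x / 200)" by (simp add: x_def)
  also have "\<dots> \<le> x - e1 - e2" using 2 3 4 by linarith
  also note 1
  finally show ?thesis .
qed

section \<open>Sets without coprime pairs\<close>

text \<open>Each further factor is at most \<open>j ^ 2 / (j ^ 2 - 1)\<close>, the quotient of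
  consecutive values of \<open>j / (j + 1)\<close>. With the constant 3.3 the bound fails at
  \<open>J = 1\<close>, so the induction starts at 2.\<close>

lemma odd_cube_product_le:
  assumes "J \<ge> 2"
  shows "(\<Prod>j=1..J. 1 + ((1 / (1 - 1 / real (2 * j + 1))) ^ 3 - 1) / real (2 * j + 1))
    \<le> 3.3 * real J / (real J + 1)"
  using assms
proof (induction J rule: nat_induct_at_least)
  case base
  have "{1..2::nat} = {1, 2}" by auto
  then show ?case by (simp add: power3_eq_cube field_simps)
next
  case (Suc J)
  define j where "j = real J + 1"
  have j: "j \<ge> 3" using Suc by (simp add: j_def)
  have e1: "1 / (1 - 1 / (2 * j + 1)) = (2 * j + 1) / (2 * j)" using j by (simp add: field_simps)
  have e2: "((1 / (1 - 1 / (2 * j + 1))) ^ 3 - 1) / (2 * j + 1) =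
      (12 * j ^ 2 + 6 * j + 1) / (8 * j ^ 3 * (2 * j + 1))"
    unfolding e1 using j
    by (simp add: divide_simps) (simp add: power2_eq_square power3_eq_cube algebra_simps)
  have "(12 * j ^ 2 + 6 * j + 1) / (8 * j ^ 3 * (2 * j + 1)) \<le> 1 / (j ^ 2 - 1)"
  proof -
    have "j ^ 2 - 1 > 0" using j by (simp add: power_strict_increasing one_less_power)
    moreover have "(12 * j ^ 2 + 6 * j + 1) * (j ^ 2 - 1) \<le> 8 * j ^ 3 * (2 * j + 1)"
    proof -
      have "0 \<le> 4 * j ^ 4 + 2 * j ^ 3 + 11 * j ^ 2 + 6 * j + 1" using j by simp
      then show ?thesis by (simp add: power2_eq_square power3_eq_cube power4_eq_xxxx algebra_simps)
    qed
    ultimately show ?thesis using j by (simp add: divide_simps)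
  qed
  moreover have "j ^ 2 - 1 > 0" using j by (simp add: power_strict_increasing one_less_power)
  then have "1 + 1 / (j ^ 2 - 1) = j ^ 2 / (j ^ 2 - 1)" by (simp add: field_simps)
  ultimately have g: "1 + ((1 / (1 - 1 / (2 * j + 1))) ^ 3 - 1) / (2 * j + 1) \<le> j ^ 2 / (j ^ 2 - 1)"
    unfolding e2 by linarith
  have jj: "real (2 * Suc J + 1) = 2 * j + 1" "real J = j - 1" by (simp_all add: j_def)
  have "(\<Prod>j=1..Suc J. 1 + ((1 / (1 - 1 / real (2 * j + 1))) ^ 3 - 1) / real (2 * j + 1)) =
     (\<Prod>j=1..J. 1 + ((1 / (1 - 1 / real (2 * j + 1))) ^ 3 - 1) / real (2 * j + 1)) *
     (1 + ((1 / (1 - 1 / (2 * j + 1))) ^ 3 - 1) / (2 * j + 1))"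
    unfolding jj(1)[symmetric] by simp
  also have "\<dots> \<le> (3.3 * real J / (real J + 1)) * (j ^ 2 / (j ^ 2 - 1))"
  proof (rule mult_mono[OF _ g])
    show "(\<Prod>j=1..J. 1 + ((1 / (1 - 1 / real (2 * j + 1))) ^ 3 - 1) / real (2 * j + 1))
        \<le> 3.3 * real J / (real J + 1)" using Suc by blast
    show "0 \<le> 1 + ((1 / (1 - 1 / (2 * j + 1))) ^ 3 - 1) / (2 * j + 1)"
      unfolding e2 using j by (intro add_nonneg_nonneg divide_nonneg_nonneg mult_nonneg_nonneg) auto
  qed auto
  also have "\<dots> = 3.3 * j / (j + 1)"
  proof -
    have "j ^ 2 - 1 = (j - 1) * (j + 1)" by (simp add: power2_eq_square algebra_simps)
    then show ?thesis using j unfolding jj(2) by (simp add: power2_eq_square divide_simps) (simp add: algebra_simps)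
  qed
  also have "\<dots> = 3.3 * real (Suc J) / (real (Suc J) + 1)" by (simp add: j_def)
  finally show ?case .
qed

lemma sum_prod_small_primes_AP_le:
  fixes a m :: nat and g :: "nat \<Rightarrow> real"
  assumes R: "finite R" "\<And>p. p \<in> R \<Longrightarrow> prime p \<and> odd p" and g: "\<And>p. p \<in> R \<Longrightarrow> g p \<ge> 0"
  shows "(\<Sum>i<m. \<Prod>p\<in>{p\<in>R. p dvd a + 2 * i}. 1 + g p) \<le> m * (\<Prod>p\<in>R. 1 + g p / p) + (\<Prod>p\<in>R. 1 + g p)"
proof -
  have dvd: "\<Prod>D dvd x \<longleftrightarrow> D \<subseteq> {p\<in>R. p dvd x}" if "D \<subseteq> R" for D x
    using prod_primes_dvd_iff[of D x] that R finite_subset[of D R] by auto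
  have oddD: "odd (\<Prod>D)" if "D \<subseteq> R" for D
    using that R prime_dvd_prod_iff[of D 2 "\<lambda>x. x"] finite_subset[of D R] by auto
  have "(\<Sum>i<m. \<Prod>p\<in>{p\<in>R. p dvd a + 2 * i}. 1 + g p) =
     (\<Sum>i<m. \<Sum>D\<in>Pow R. of_bool (\<Prod>D dvd a + 2 * i) * prod g D)"
  proof (rule sum.cong[OF refl])
    fix i
    have "(\<Prod>p\<in>{p\<in>R. p dvd a + 2 * i}. 1 + g p) = (\<Sum>D\<in>Pow {p\<in>R. p dvd a + 2 * i}. prod g D)"
      using R by (intro prod_one_add) auto
    also have "\<dots> = (\<Sum>D\<in>Pow R. of_bool (\<Prod>D dvd a + 2 * i) * prod g D)"
      using R dvd by (intro sum.mono_neutral_cong_left) auto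
    finally show "(\<Prod>p\<in>{p\<in>R. p dvd a + 2 * i}. 1 + g p) =
       (\<Sum>D\<in>Pow R. of_bool (\<Prod>D dvd a + 2 * i) * prod g D)" .
  qed
  also have "\<dots> = (\<Sum>D\<in>Pow R. \<Sum>i<m. of_bool (\<Prod>D dvd a + 2 * i) * prod g D)"
    by (rule sum.swap)
  also have "\<dots> = (\<Sum>D\<in>Pow R. card {i\<in>{..<m}. \<Prod>D dvd a + 2 * i} * prod g D)"
    by (simp add: sum_distrib_right[symmetric] sum_of_bool_eq Int_def)
  also have "\<dots> \<le> (\<Sum>D\<in>Pow R. (m / real (\<Prod>D) + 1) * prod g D)"
    using oddD g by (intro sum_mono mult_right_mono card_AP_dvd prod_nonneg) auto
  also have "\<dots> = m * (\<Sum>D\<in>Pow R. prod g D / real (\<Prod>D)) + (\<Sum>D\<in>Pow R. prod g D)"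
    by (simp add: algebra_simps sum.distrib sum_distrib_left)
  also have "(\<Sum>D\<in>Pow R. prod g D / real (\<Prod>D)) = (\<Prod>p\<in>R. 1 + g p / p)"
    using prod_one_add[OF R(1), of "\<lambda>p. g p / p"] by (simp add: prod_dividef)
  also have "(\<Sum>D\<in>Pow R. prod g D) = (\<Prod>p\<in>R. 1 + g p)"
    using prod_one_add[OF R(1), of g] by simp
  finally show ?thesis .
qed

text \<open>At most \<open>W\<close> primes above \<open>z\<close> divide \<open>y\<close>, each
  with factor at least \<open>1 - 1 / z\<close>. By Bernoulli their cubed product is at least
  \<open>1 - 3 W / z = 0.99\<close>.\<close>

lemma inverse_cube_odd_totient_ratio_le:
  assumes "0 < y" "y \<le> 2 ^ W" "0 < W" "z = 300 * W"
  shows "(1 / odd_totient_ratio y) ^ 3 \<le>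
    (\<Prod>p\<in>{p\<in>{p. prime p \<and> odd p \<and> p \<le> z}. p dvd y}. 1 + ((1 / (1 - 1 / real p)) ^ 3 - 1)) / 0.99"
proof -
  define A where "A = {p\<in>{p. prime p \<and> odd p \<and> p \<le> z}. p dvd y}"
  define B where "B = {p\<in>odd_primes_of y. z < p}"
  have fin: "finite A" "finite B" unfolding A_def B_def
    using finite_odd_primes_of assms by auto
  have split: "odd_primes_of y = A \<union> B" "A \<inter> B = {}"
    unfolding A_def B_def odd_primes_of_def by auto
  define f where "f = (\<lambda>p. 1 - 1 / real p)"
  have f: "f p > 0" if "p \<ge> 2" for p
    using that unfolding f_def by (simp add: field_simps)
  have fA: "prod f A > 0" and fB: "prod f B > 0"
    unfolding A_def B_def odd_primes_of_def using f prime_ge_2_nat by (auto intro!: prod_pos)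
  have z: "real z = 300 * real W" "real z > 1" using assms by auto
  have cB: "card B \<le> W"
    using card_odd_primes_of[OF assms(1,2)] card_mono[of "odd_primes_of y" B] split
      finite_odd_primes_of[OF assms(1)] by auto
  have "(1 - 1 / real z) ^ W \<le> (1 - 1 / real z) ^ card B"
    using z cB by (intro power_decreasing) auto
  also have "\<dots> = (\<Prod>p\<in>B. 1 - 1 / real z)" by simp
  also have "\<dots> \<le> (\<Prod>p\<in>B. f p)" using z
    by (intro prod_mono) (auto simp: B_def f_def intro!: frac_le)
  finally have "((1 - 1 / real z) ^ W) ^ 3 \<le> (\<Prod>p\<in>B. f p) ^ 3"
    using z by (intro power_mono) auto
  moreover have "((1 - 1 / real z) ^ W) ^ 3 \<ge> 0.99"
  proof -
    have "1 + real (W * 3) * (- 1 / real z) \<le> (1 + (- 1 / real z)) ^ (W * 3)"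
      using z by (intro Bernoulli_inequality) auto
    moreover have "real (W * 3) * (- 1 / real z) = - 0.01" using z assms by simp
    ultimately show ?thesis by (simp add: power_mult)
  qed
  ultimately have B: "(\<Prod>p\<in>B. f p) ^ 3 \<ge> 0.99" by linarith
  have "odd_totient_ratio y = prod f A * prod f B"
    unfolding odd_totient_ratio_def split f_def[symmetric] using fin split
    by (subst prod.union_disjoint) (auto simp: f_def)
  then have "(1 / odd_totient_ratio y) ^ 3 = (1 / prod f A) ^ 3 / (prod f B) ^ 3"
    by (simp add: power_divide power_mult_distrib)
  also have "\<dots> \<le> (1 / prod f A) ^ 3 / 0.99"
    using B fA fB by (intro divide_left_mono) auto
  also have "(1 / prod f A) ^ 3 = (\<Prod>p\<in>A. 1 + ((1 / f p) ^ 3 - 1))"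
    by (simp add: prod_dividef prod_power_distrib power_divide)
  finally show ?thesis unfolding A_def f_def .
qed

text \<open>Only primes up to \<open>z\<close> are kept. Enlarging them to odd numbers bounds the
  main product by 3.3, the error product is at most \<open>z ^ 3 \<le> m / 100\<close>, and
  \<open>(3.3 + 0.01) / 0.99 < 3.4\<close>.\<close>

lemma third_moment_AP_le:
  fixes a m W :: nat
  assumes pos: "\<And>i. i < m \<Longrightarrow> 0 < a + 2 * i \<and> a + 2 * i \<le> 2 ^ W" and W: "0 < W"
    and m: "100 * (300 * W) ^ 3 \<le> m"
  shows "(\<Sum>i<m. (1 / odd_totient_ratio (a + 2 * i)) ^ 3) \<le> 3.4 * m"
proof -
  define z where "z = 300 * W"
  define R where "R = {p. prime p \<and> odd p \<and> p \<le> z}"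
  \<comment> \<open>\<open>1 + g p\<close> is the local factor at \<open>p\<close> of the cubed
    inverse ratio.\<close>
  define g where "g p = (1 / (1 - 1 / real p)) ^ 3 - 1" for p
  have fR: "finite R" unfolding R_def by auto
  have R3: "p \<ge> 3" if "p \<in> R" for p
    using that prime_ge_2_nat[of p] unfolding R_def by (cases "p = 2") auto
  have g0: "g p \<ge> 0" if "p \<ge> 2" for p
    using that unfolding g_def by (simp add: field_simps)
  have g0': "1 + g p / real p \<ge> 1" if "p \<ge> 2" for p
    using g0[OF that] by simp
  have prod1: "(\<Prod>p\<in>R. 1 + g p / p) \<le> 3.3"
  proof -
    have sub: "R \<subseteq> (\<lambda>j. 2 * j + 1) ` {1..z}"
    proof
      fix p assume p: "p \<in> R"
      then obtain j where "p = 2 * j + 1" unfolding R_def by (auto elim: oddE)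
      then show "p \<in> (\<lambda>j. 2 * j + 1) ` {1..z}" using R3[OF p] p unfolding R_def by auto
    qed
    have "(\<Prod>p\<in>R. 1 + g p / p) \<le> (\<Prod>p\<in>(\<lambda>j. 2 * j + 1) ` {1..z}. 1 + g p / p)"
    proof (rule prod_mono2[OF _ sub])
      show "1 \<le> 1 + g p / real p" if "p \<in> (\<lambda>j. 2 * j + 1) ` {1..z} - R" for p
        using that by (intro g0') auto
      show "0 \<le> 1 + g p / real p" if "p \<in> R" for p
        using g0'[of p] R3[OF that] by linarith
    qed auto
    also have "\<dots> = (\<Prod>j=1..z. 1 + g (2 * j + 1) / real (2 * j + 1))"
      by (subst prod.reindex) (auto simp: inj_on_def)
    also have "\<dots> \<le> 3.3 * real z / (real z + 1)" unfolding g_def using W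
      by (intro odd_cube_product_le) (auto simp: z_def)
    also have "\<dots> \<le> 3.3" by (simp add: field_simps)
    finally show ?thesis .
  qed
  have prod2: "(\<Prod>p\<in>R. 1 + g p) \<le> m / 100"
  proof -
    have "p \<in> {2..z}" if "p \<in> R" for p using R3[OF that] that by (simp add: R_def)
    then have "R \<subseteq> {2..z}" by blast
    then have "card R \<le> z - 1" using card_mono[of "{2..z}" R] by simp
    then have c: "real (card R + 1) \<le> z" using W by (simp add: z_def)
    have pr: "(\<Prod>p\<in>R. 1 - 1 / real p) \<ge> 1 / (card R + 1)"
    proof (rule prod_one_minus_inverse_ge[OF fR])
      show "2 \<le> p" if "p \<in> R" for p using R3[OF that] by simp
    qed
    have pos: "(\<Prod>p\<in>R. 1 - 1 / real p) > 0"
      by (rule less_le_trans[OF _ pr]) (simp add: divide_pos_pos)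
    have "(\<Prod>p\<in>R. 1 + g p) = (1 / (\<Prod>p\<in>R. 1 - 1 / real p)) ^ 3"
      unfolding g_def by (simp add: prod_dividef prod_power_distrib power_divide)
    also have "\<dots> \<le> (real z) ^ 3"
    proof (rule power_mono)
      have "1 / (\<Prod>p\<in>R. 1 - 1 / real p) \<le> 1 / (1 / real (card R + 1))"
        using pr pos by (intro divide_left_mono mult_pos_pos) auto
      then show "1 / (\<Prod>p\<in>R. 1 - 1 / real p) \<le> real z" using c by simp
      show "0 \<le> 1 / (\<Prod>p\<in>R. 1 - 1 / real p)" using pos by simp
    qed
    also have "\<dots> \<le> m / 100"
    proof -
      have "real (100 * z ^ 3) \<le> real m" using m unfolding z_def[symmetric] by (simp only: of_nat_le_iff)
      then show ?thesis by simp
    qed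
    finally show ?thesis .
  qed
  have "(\<Sum>i<m. (1 / odd_totient_ratio (a + 2 * i)) ^ 3) \<le>
     (\<Sum>i<m. (\<Prod>p\<in>{p\<in>R. p dvd a + 2 * i}. 1 + g p) / 0.99)"
    unfolding R_def g_def using pos W z_def
    by (intro sum_mono inverse_cube_odd_totient_ratio_le) auto
  also have "\<dots> \<le> (m * (\<Prod>p\<in>R. 1 + g p / p) + (\<Prod>p\<in>R. 1 + g p)) / 0.99"
    unfolding sum_divide_distrib[symmetric]
  proof (intro divide_right_mono sum_prod_small_primes_AP_le fR)
    show "g p \<ge> 0" if "p \<in> R" for p using R3[OF that] g0[of p] by simp
  qed (auto simp: R_def)
  also have "\<dots> \<le> (m * 3.3 + m / 100) / 0.99"
    by (intro divide_right_mono add_mono mult_left_mono prod1 prod2) auto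
  also have "\<dots> \<le> 3.4 * real m" by simp
  finally show ?thesis .
qed

text \<open>
  With \<open>u = m - card S\<close>, every \<open>y \<in> T\<close> is coprime (up to 2) to at most \<open>u\<close> terms of the first progression,
  so by the sieve its totient ratio is at most about \<open>u / m\<close>. By the third moment there are fewer than
  \<open>3.6 m (u / m)^3 < u\<close> such \<open>y\<close>, using \<open>u \<le> m / 2\<close>; the second moment would leave hardly any slack here.
\<close>
lemma non_coprime_AP_card_le_aux:
  fixes a b m k W :: nat and S T :: "nat set"
  assumes k: "odd k" "200 * (W + 2) ^ 3 \<le> 2 ^ k" and m: "200 * (W + 2) ^ (k + 1) \<le> m" "100 * (300 * W) ^ 3 \<le> m"
    and W: "0 < W"
    and pos: "\<And>i. i < m \<Longrightarrow> 0 < b + 2 * i \<and> b + 2 * i \<le> 2 ^ W"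
    and S: "S \<subseteq> (\<lambda>i. a + 2 * i) ` {..<m}" and T: "T \<subseteq> (\<lambda>i. b + 2 * i) ` {..<m}"
    and ST: "\<And>x y. x \<in> S \<Longrightarrow> y \<in> T \<Longrightarrow> \<exists>p. prime p \<and> odd p \<and> p dvd x \<and> p dvd y"
    and le: "card T \<le> card S"
  shows "card S + card T \<le> m"
proof (rule ccontr)
  assume "\<not> card S + card T \<le> m"
  then have gt: "card S + card T > m" by simp
  have fS: "finite S" using S finite_subset by blast
  have cU: "card ((\<lambda>i. a + 2 * i) ` {..<m}) = m"
    by (subst card_image) (auto simp: inj_on_def)
  have "card S \<le> m" using card_mono[OF _ S] cU by simp
  define u where "u = m - card S"
  have u: "u < card T" "2 * u \<le> m" "card S = m - u" using gt le \<open>card S \<le> m\<close> by (auto simp: u_def)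
  have m0: "real m > 0" using gt \<open>card S \<le> m\<close> le by linarith
  have deg: "0.99 * m * odd_totient_ratio y \<le> u \<and> 0 < odd_totient_ratio y" if y: "y \<in> T" for y
  proof -
    have y0: "0 < y" "y \<le> 2 ^ W" using y T pos by auto
    define G where "G = {i\<in>{..<m}. \<forall>p\<in>odd_primes_of y. \<not> p dvd a + 2 * i}"
    have "0.99 * m * odd_totient_ratio y \<le> card G"
      unfolding G_def using y0 k m by (intro card_coprime_AP_ge)
    moreover have "card S + card G \<le> m"
    proof -
      have "card G = card ((\<lambda>i. a + 2 * i) ` G)"
        by (subst card_image) (auto simp: inj_on_def)
      moreover have "S \<inter> (\<lambda>i. a + 2 * i) ` G = {}"
      proof (rule ccontr)
        assume "S \<inter> (\<lambda>i. a + 2 * i) ` G \<noteq> {}"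
        then obtain i where i: "i \<in> G" "a + 2 * i \<in> S" by blast
        then show False using ST[OF i(2) y] by (auto simp: G_def odd_primes_of_def)
      qed
      moreover have "finite ((\<lambda>i. a + 2 * i) ` G)" by (simp add: G_def)
      ultimately have cun: "card (S \<union> (\<lambda>i. a + 2 * i) ` G) = card S + card G"
        using fS card_Un_disjoint[of S "(\<lambda>i. a + 2 * i) ` G"] by simp
      have sub: "S \<union> (\<lambda>i. a + 2 * i) ` G \<subseteq> (\<lambda>i. a + 2 * i) ` {..<m}"
        using S by (auto simp: G_def)
      have "card (S \<union> (\<lambda>i. a + 2 * i) ` G) \<le> m"
        using card_mono[OF _ sub] cU by simp
      then show ?thesis using cun by simp
    qed
    ultimately show ?thesis using odd_totient_ratio_pos[OF y0(1)] u_def by linarith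
  qed
  obtain y where "y \<in> T" using u by (cases "T = {}") auto
  then have "0 < 0.99 * m * odd_totient_ratio y" using deg m0 by simp
  then have u0: "real u > 0" using deg[OF \<open>y \<in> T\<close>] by linarith
  define I where "I = {i\<in>{..<m}. b + 2 * i \<in> T}"
  have "T = (\<lambda>i. b + 2 * i) ` I" using T by (auto simp: I_def)
  then have cT: "card T = card I" by (simp add: card_image inj_on_def)
  have "real (card T) * (0.99 * m / u) ^ 3 = (\<Sum>i\<in>I. (0.99 * m / u) ^ 3)" by (simp add: cT)
  also have "\<dots> \<le> (\<Sum>i\<in>I. (1 / odd_totient_ratio (b + 2 * i)) ^ 3)"
  proof (intro sum_mono power_mono)
    fix i assume "i \<in> I"
    then have d: "0.99 * m * odd_totient_ratio (b + 2 * i) \<le> u" "0 < odd_totient_ratio (b + 2 * i)"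
      using deg by (auto simp: I_def)
    then show "0.99 * m / u \<le> 1 / odd_totient_ratio (b + 2 * i)"
      using u0 by (simp only: le_divide_eq divide_le_eq) (simp add: mult_ac divide_le_eq)
  qed auto
  also have "\<dots> \<le> (\<Sum>i<m. (1 / odd_totient_ratio (b + 2 * i)) ^ 3)"
  proof (rule sum_mono2)
    show "0 \<le> (1 / odd_totient_ratio (b + 2 * i)) ^ 3" if "i \<in> {..<m} - I" for i
      using odd_totient_ratio_pos[of "b + 2 * i"] pos[of i] that by simp
  qed (auto simp: I_def)
  also have "\<dots> \<le> 3.4 * m" using pos W m(2) by (rule third_moment_AP_le)
  finally have 1: "real (card T) * (0.99 * m / u) ^ 3 \<le> 3.4 * m" .
  \<comment> \<open>As \<open>u \<le> m / 2\<close>, the cube of \<open>m / u\<close> is at least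
    \<open>4 m / u\<close>, and \<open>4 * 0.99 ^ 3 > 3.8\<close>. Since 3.8 exceeds 3.4,
    \<open>T\<close> has fewer than \<open>u\<close> elements.\<close>
  have r2: "real m / real u \<ge> 2" using u(2) u0 by (simp add: le_divide_eq flip: of_nat_mult)
  have "(real m / real u) ^ 3 = (real m / real u) ^ 2 * (real m / real u)"
    by (simp add: power2_eq_square power3_eq_cube)
  also have "\<dots> \<ge> 2 ^ 2 * (real m / real u)"
    using r2 by (intro mult_right_mono power_mono) auto
  finally have "(0.99 * m / u) ^ 3 \<ge> 3.8 * (real m / real u)"
    using r2 by (simp add: power_divide power_mult_distrib)
  then have "real (card T) * (3.8 * (real m / real u)) \<le> real (card T) * (0.99 * m / u) ^ 3"
    by (intro mult_left_mono) auto
  then have "real (card T) * (3.8 * (real m / real u)) \<le> 3.4 * m" using 1 by linarith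
  then have "3.8 * real (card T) \<le> 3.4 * real u" using u0 m0 by (simp add: field_simps)
  then show False using u(1) by linarith
qed

text \<open>A common prime of two numbers of opposite parity is odd, and by symmetry the larger set
  may take the part of \<open>S\<close>.\<close>

lemma non_coprime_AP_card_le:
  fixes a b m k W :: nat and S T :: "nat set"
  assumes k: "odd k" "200 * (W + 2) ^ 3 \<le> 2 ^ k" and m: "200 * (W + 2) ^ (k + 1) \<le> m" "100 * (300 * W) ^ 3 \<le> m"
    and W: "0 < W"
    and pos: "\<And>i. i < m \<Longrightarrow> 0 < a + 2 * i \<and> a + 2 * i \<le> 2 ^ W"
      "\<And>i. i < m \<Longrightarrow> 0 < b + 2 * i \<and> b + 2 * i \<le> 2 ^ W"
    and S: "S \<subseteq> (\<lambda>i. a + 2 * i) ` {..<m}" and T: "T \<subseteq> (\<lambda>i. b + 2 * i) ` {..<m}"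
    and odd: "odd (a + b)"
    and ST: "\<And>x y. x \<in> S \<Longrightarrow> y \<in> T \<Longrightarrow> \<not> coprime x y"
  shows "card S + card T \<le> m"
proof -
  have ST': "\<exists>p. prime p \<and> odd p \<and> p dvd x \<and> p dvd y" if xy: "x \<in> S" "y \<in> T" for x y
  proof -
    have "gcd x y \<noteq> 1" using ST[OF xy] by (metis coprime_iff_gcd_eq_1)
    then obtain p where p: "prime p" "p dvd gcd x y" using prime_factor_nat by blast
    then have p: "prime p" "p dvd x" "p dvd y" by auto
    have "odd x \<or> odd y" using xy S T odd by auto
    then have "odd p" using p by auto
    then show ?thesis using p by blast
  qed
  show ?thesis
  proof (cases "card T \<le> card S")
    case True
    then show ?thesis by (intro non_coprime_AP_card_le_aux[OF k m W pos(2) S T ST'])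
  next
    case False
    have "card T + card S \<le> m" using False ST'
      by (intro non_coprime_AP_card_le_aux[OF k m W pos(1) T S]) auto
    then show ?thesis by simp
  qed
qed

text \<open>Two even numbers are never coprime, so only opposite parities are compared; each of the
  two comparisons contributes at most \<open>m\<close>.\<close>

lemma non_coprime_intervals_card_le:
  fixes x0 y0 m k W :: nat and S T :: "nat set"
  assumes k: "odd k" "200 * (W + 2) ^ 3 \<le> 2 ^ k" and m: "200 * (W + 2) ^ (k + 1) \<le> m" "100 * (300 * W) ^ 3 \<le> m"
    and W: "0 < W"
    and S: "S \<subseteq> {x0<..x0 + 2 * m}" and T: "T \<subseteq> {y0<..y0 + 2 * m}"
    and le: "x0 + 2 * m \<le> 2 ^ W" "y0 + 2 * m \<le> 2 ^ W"
    and ST: "\<And>x y. x \<in> S \<Longrightarrow> y \<in> T \<Longrightarrow> \<not> coprime x y"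
  shows "card S + card T \<le> 2 * m"
proof -
  \<comment> \<open>\<open>e c\<close> and \<open>o' c\<close> are the first even and the first odd
    number above \<open>c\<close>.\<close>
  define e where "e c = (if even c then c + 2 else c + 1)" for c :: nat
  define o' where "o' c = (if even c then c + 1 else c + 2)" for c :: nat
  have ee: "even (e c)" "odd (o' c)" for c by (auto simp: e_def o'_def)
  have ev: "{x\<in>R. even x} \<subseteq> (\<lambda>i. e c + 2 * i) ` {..<m}" if R: "R \<subseteq> {c<..c + 2 * m}" for R c
  proof
    fix x assume "x \<in> {x\<in>R. even x}"
    then have x: "c < x" "x \<le> c + 2 * m" "even x" using R by auto
    then have "e c \<le> x" by (auto simp: e_def) presburger
    then obtain d where d: "x = e c + d" by (metis le_iff_add)
    then have "even d" using x ee by simp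
    then obtain i where "x = e c + 2 * i" using d by (auto elim: evenE)
    moreover from this have "i < m" using x by (auto simp: e_def split: if_splits)
    ultimately show "x \<in> (\<lambda>i. e c + 2 * i) ` {..<m}" by auto
  qed
  have od: "{x\<in>R. odd x} \<subseteq> (\<lambda>i. o' c + 2 * i) ` {..<m}" if R: "R \<subseteq> {c<..c + 2 * m}" for R c
  proof
    fix x assume "x \<in> {x\<in>R. odd x}"
    then have x: "c < x" "x \<le> c + 2 * m" "odd x" using R by auto
    then have "o' c \<le> x" by (auto simp: o'_def) presburger
    then obtain d where d: "x = o' c + d" by (metis le_iff_add)
    then have "even d" using x ee by simp
    then obtain i where "x = o' c + 2 * i" using d by (auto elim: evenE)
    moreover from this have "i < m" using x by (auto simp: o'_def split: if_splits)
    ultimately show "x \<in> (\<lambda>i. o' c + 2 * i) ` {..<m}" by auto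
  qed
  have pos: "0 < e c + 2 * i \<and> e c + 2 * i \<le> 2 ^ W" "0 < o' c + 2 * i \<and> o' c + 2 * i \<le> 2 ^ W"
    if "i < m" "c + 2 * m \<le> 2 ^ W" for c i
    using that by (auto simp: e_def o'_def)
  have 1: "card {x\<in>S. even x} + card {y\<in>T. odd y} \<le> m"
    using pos le ee ST by (intro non_coprime_AP_card_le[OF k m W _ _ ev[OF S] od[OF T]]) auto
  have 2: "card {x\<in>S. odd x} + card {y\<in>T. even y} \<le> m"
    using pos le ee ST by (intro non_coprime_AP_card_le[OF k m W _ _ od[OF S] ev[OF T]]) auto
  have split: "card R = card {x\<in>R. even x} + card {x\<in>R. odd x}" if "R \<subseteq> {c<..c + 2 * m}" for R c
  proof -
    have "finite R" using that finite_subset by blast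
    then have "card ({x\<in>R. even x} \<union> {x\<in>R. odd x}) = card {x\<in>R. even x} + card {x\<in>R. odd x}"
      by (intro card_Un_disjoint) auto
    moreover have "{x\<in>R. even x} \<union> {x\<in>R. odd x} = R" by auto
    ultimately show ?thesis by simp
  qed
  show ?thesis using 1 2 split[OF S] split[OF T] by linarith
qed

section \<open>Sufficient conditions for looseness\<close>

definition loose :: "nat \<Rightarrow> nat set \<Rightarrow> bool" where
  "loose n V \<longleftrightarrow> (\<exists>t::real. \<forall>v\<in>V. 1 / (real n + 1) < frac (real v * t) \<and>
     frac (real v * t) < real n / (real n + 1))"

text \<open>All times used below have the form \<open>s / q + e\<close>: the residue of
  \<open>v s\<close> gives the position on the circle and \<open>v e\<close> the shift.\<close>

lemma frac_eq_mod_div_add: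
  fixes v s q :: nat and e :: real
  assumes "q > 0" "0 \<le> real (v * s mod q) / q + v * e" "real (v * s mod q) / q + v * e < 1"
  shows "frac (real v * (real s / real q + e)) = real (v * s mod q) / q + v * e"
proof -
  have "real (v * s) / real q = real (v * s div q) + real (v * s mod q) / real q"
    by (rule of_nat_of_nat_div_aux)
  then have "real v * (real s / real q + e) - (real (v * s mod q) / q + v * e) = real (v * s div q)"
    by (simp add: distrib_left)
  then show ?thesis using assms by (simp add: frac_unique_iff)
qed

text \<open>At time \<open>1 / q\<close> every non-multiple of \<open>q\<close> is at distance at
  least \<open>1 / q > 1 / (n + 1)\<close> from the integers.\<close>

lemma loose_if_no_multiple:
  assumes q: "0 < q" "q \<le> n" and V: "\<And>v. v \<in> V \<Longrightarrow> \<not> q dvd v"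
  shows "loose n V"
  unfolding loose_def
proof (intro exI ballI)
  fix v assume v: "v \<in> V"
  define b where "b = v mod q"
  have b: "1 \<le> b" "b + 1 \<le> q" using V[OF v] q by (auto simp: b_def dvd_eq_mod_eq_0 Suc_le_eq)
  have "real b / q \<ge> 1 / q" using b by (intro divide_right_mono) auto
  moreover have "1 / real q > 1 / (real n + 1)" using q by (intro divide_strict_left_mono) auto
  moreover have "real b / q \<le> (real q - 1) / q" using b by (intro divide_right_mono) auto
  moreover have "(real q - 1) / q = 1 - 1 / q" using q by (simp add: field_simps)
  moreover have "real n / (real n + 1) = 1 - 1 / (real n + 1)" by (simp add: field_simps)
  moreover have "real b / q < 1" using b by simp
  moreover have "frac (real v * (real 1 / real q + 0)) = real (v * 1 mod q) / q + real v * 0"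
    using q b by (intro frac_eq_mod_div_add) (auto simp: b_def)
  ultimately show "1 / (real n + 1) < frac (real v * (1 / real q)) \<and>
     frac (real v * (1 / real q)) < real n / (real n + 1)" by (simp add: b_def)
qed

text \<open>The time is \<open>s / (x + y)\<close> with \<open>s\<close> inverse to \<open>x\<close>: only \<open>x\<close> and \<open>y\<close> land next to an integer.\<close>
lemma loose_if_coprime_gaps:
  assumes x: "0 < x" "0 < y" "coprime x y" "x \<notin> V" "y \<notin> V" and V: "V \<subseteq> {0<..<x + y}"
    and n: "x + y \<le> 2 * n + 1"
  shows "loose n V"
proof -
  define q where "q = x + y"
  have q0: "q > 0" using x by (simp add: q_def)
  have cxq: "coprime x q" using x(3) unfolding q_def coprime_iff_gcd_eq_1 by (simp only: gcd_add2)
  obtain s where s: "[x * s = 1] (mod q)" using cong_solve_coprime_nat[OF cxq] by auto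
  then have "[s * x = Suc 0] (mod q)" by (simp add: mult.commute)
  then have cs: "coprime s q" using coprime_iff_invertible_nat by blast
  show ?thesis unfolding loose_def
  proof (intro exI ballI)
    fix v assume v: "v \<in> V"
    then have v0: "0 < v" "v < q" "v \<noteq> x" "v \<noteq> y" using V x q_def by auto
    define b where "b = v * s mod q"
    have bq: "b < q" using q0 by (simp add: b_def)
    have "b \<noteq> 0"
    proof
      assume "b = 0"
      then have "q dvd v * s" by (auto simp: b_def)
      then have "q dvd v" using cs by (simp add: coprime_commute coprime_dvd_mult_left_iff)
      then show False using v0 by (auto dest: dvd_imp_le)
    qed
    moreover have "b \<noteq> 1"
    proof
      assume b1: "b = 1"
      then have "[v * s = x * s] (mod q)" using s bq unfolding b_def cong_def by simp
      then have "[v = x] (mod q)" using cs by (simp add: cong_mult_rcancel_nat coprime_commute)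
      moreover have "x < q" using x by (simp add: q_def)
      ultimately show False using v0 by (simp add: cong_def)
    qed
    \<comment> \<open>Residue \<open>q - 1\<close> makes \<open>v + x\<close> a multiple of
      \<open>q\<close> strictly between 0 and \<open>2 q\<close>, hence
      \<open>v = y\<close>.\<close>
    moreover have "b \<noteq> q - 1"
    proof
      assume b1: "b = q - 1"
      have "[v * s = q - 1] (mod q)" unfolding cong_def using b1 q0 by (simp add: b_def)
      then have "[v * s + x * s = (q - 1) + 1] (mod q)" using s by (rule cong_add)
      then have "q dvd (v + x) * s" using q0 by (simp add: cong_def distrib_right mod_eq_0_iff_dvd)
      then have "q dvd v + x" using cs by (simp add: coprime_commute coprime_dvd_mult_left_iff)
      then obtain c where c: "v + x = q * c" by (elim dvdE)
      have "0 < v + x" "v + x < q * 2" using v0 x by (auto simp: q_def)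
      then have "0 < c" "c < 2" using c by auto
      then have "c = 1" by simp
      then show False using c v0 by (simp add: q_def)
    qed
    ultimately have b: "2 \<le> b" "b + 2 \<le> q" using bq by auto
    \<comment> \<open>Here \<open>x + y \<le> 2 n + 1\<close> enters: distance \<open>2 / q\<close>
      from the integers suffices.\<close>
    have "real q < 2 * (real n + 1)" using n by (simp add: q_def)
    then have "2 / real q > 1 / (real n + 1)" using q0 by (simp add: field_simps)
    moreover have "real b / q \<ge> 2 / q" using b by (intro divide_right_mono) auto
    moreover have "real b / q \<le> (real q - 2) / q" using b by (intro divide_right_mono) auto
    moreover have "(real q - 2) / q = 1 - 2 / q" using q0 by (simp add: field_simps)
    moreover have "real n / (real n + 1) = 1 - 1 / (real n + 1)" by (simp add: field_simps)
    moreover have "real b / q < 1" using b by simp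
    moreover have "frac (real v * (real s / real q + 0)) = real (v * s mod q) / q + real v * 0"
      using q0 b by (intro frac_eq_mod_div_add) (auto simp: b_def)
    ultimately show "1 / (real n + 1) < frac (real v * (real s / real q)) \<and>
       frac (real v * (real s / real q)) < real n / (real n + 1)" by (simp add: b_def)
  qed
qed

text \<open>
  The time is \<open>s / q + e\<close> with \<open>s a \<equiv> -1\<close> and \<open>e\<close> slightly above \<open>1 / (2 q (n + 1))\<close>. The multiples of \<open>q\<close>
  in \<open>V\<close> are at least \<open>2 q\<close>, hence pushed far enough from 0; only a large \<open>v \<equiv> a\<close> could be pushed too
  close to 1.
\<close>
lemma loose_if_perturbation:
  fixes a q n N :: nat
  assumes q: "0 < q" "q \<le> n" "q \<notin> V" and V: "V \<subseteq> {0<..N}" and N: "N + 1 \<le> 2 * n"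
    and a: "coprime a q" and gap: "\<And>v. v \<in> V \<Longrightarrow> [v = a] (mod q) \<Longrightarrow> v + 2 * q < 2 * n + 2"
  shows "loose n V"
proof -
  obtain s' where s': "[a * s' = 1] (mod q)" using cong_solve_coprime_nat[OF a] by auto
  \<comment> \<open>The factor \<open>q - 1\<close> acts as -1 modulo \<open>q\<close>.\<close>
  define s where "s = (q - 1) * s'"
  have "[s' * a = Suc 0] (mod q)" using s' by (simp add: mult.commute)
  then have "coprime s' q" using coprime_iff_invertible_nat by blast
  moreover have "coprime (q - 1) q" using q coprime_diff_one_left_nat by simp
  ultimately have cs: "coprime s q" by (simp add: s_def)
  have "[a * s' * (q - 1) = 1 * (q - 1)] (mod q)" by (intro cong_mult s' cong_refl)
  then have "[a * s + 1 = (q - 1) + 1] (mod q)" unfolding s_def by (intro cong_add) (auto simp: mult_ac)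
  then have as: "[a * s + 1 = 0] (mod q)" using q by (simp add: cong_def)
  define M where "M = real n + 1"
  \<comment> \<open>The factor \<open>1 + 1 / (2 M)\<close> makes \<open>v e > 1 / M\<close> strict
    for \<open>v \<ge> 2 q\<close>, while \<open>v < 2 M\<close> keeps \<open>v e\<close> below
    \<open>(v + 1) / (2 q M)\<close>.\<close>
  define e where "e = (1 + 1 / (2 * M)) / (2 * q * M)"
  have M: "M > 1" "real n = M - 1" using q by (auto simp: M_def)
  have qM: "2 * q * M > 0" using q M by simp
  have "1 / real n > 1 / M" using M q by (intro divide_strict_left_mono) auto
  moreover have "1 / real q \<ge> 1 / n" using q by (intro divide_left_mono) auto
  ultimately have qn: "1 / real q > 1 / M" by linarith
  show ?thesis unfolding loose_def
  proof (intro exI ballI)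
    fix v assume v: "v \<in> V"
    then have v0: "0 < v" "v \<le> N" "v \<noteq> q" using V q by auto
    have "real v < 2 * M" using v0 N by (simp add: M_def)
    then have "real v * (1 + 1 / (2 * M)) < real v + 1" using M by (simp add: field_simps)
    then have up: "v * e < (real v + 1) / (2 * q * M)"
      unfolding e_def using qM by (simp add: divide_strict_right_mono)
    have "real v < real v * (1 + 1 / (2 * M))" using v0 M by simp
    then have lo: "v * e > real v / (2 * q * M)"
      unfolding e_def using qM by (simp add: divide_strict_right_mono)
    have "real v + 1 \<le> 2 * (M - 1)" using v0 N by (simp add: M_def)
    then have "(real v + 1) / (2 * q * M) \<le> (2 * (M - 1)) / (2 * q * M)"
      by (rule divide_right_mono[OF _ less_imp_le[OF qM]])
    also have "\<dots> = 1 / q - 1 / (q * M)" using q M by (simp add: field_simps)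
    finally have up2: "v * e < 1 / q - 1 / (q * M)" using up by linarith
    have "0 < real v / (2 * q * M)" using v0 qM by (intro divide_pos_pos) auto
    then have e0: "v * e > 0" using lo by linarith
    have qM1: "1 / (q * M) > 0" using q M by simp
    define b where "b = v * s mod q"
    have bq: "b < q" using q by (simp add: b_def)
    have main: "1 / M < real b / q + v * e \<and> real b / q + v * e < 1 - 1 / M"
    proof -
      consider "b = 0" | "1 \<le> b" "b + 2 \<le> q" | "1 \<le> b" "b + 1 = q" using bq by linarith
      then show ?thesis
      proof cases
        case 1
        then have "q dvd v * s" by (auto simp: b_def)
        then have "q dvd v" using cs by (simp add: coprime_commute coprime_dvd_mult_left_iff)
        then obtain c where c: "v = q * c" by (elim dvdE)
        then have "c \<noteq> 0" "c \<noteq> 1" using v0 by auto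
        then have "2 * q \<le> v" using c by simp
        then have "real (2 * q) \<le> real v" by (simp only: of_nat_le_iff)
        then have "(2 * q) / (2 * q * M) \<le> real v / (2 * q * M)" using qM by (intro divide_right_mono) auto
        then have "1 / M < v * e" using lo q by simp
        moreover have "v * e < 1 - 1 / M"
        proof -
          have "1 / q - 1 / (q * M) = (1 - 1 / M) / q" by (simp add: diff_divide_distrib)
          also have "\<dots> \<le> (1 - 1 / M) / 1" using q M by (intro divide_left_mono) auto
          finally show ?thesis using up2 by simp
        qed
        ultimately show ?thesis using 1 by simp
      next
        case 2
        have "real b / q \<ge> 1 / q" using 2 by (intro divide_right_mono) auto
        moreover have "real b / q \<le> (real q - 2) / q" using 2 by (intro divide_right_mono) auto
        moreover have "(real q - 2) / q = 1 - 2 * (1 / q)" using q by (simp add: field_simps)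
        ultimately show ?thesis using e0 up2 qM1 qn by linarith
      next
        case 3
        have b1: "real b / q = 1 - 1 / q" using 3(2) q by (simp add: field_simps)
        have "[v * s + 1 = b + 1] (mod q)" by (intro cong_add) (auto simp: b_def cong_def)
        then have "[v * s + 1 = 0] (mod q)" using 3 by (simp add: cong_def)
        then have "[v * s + 1 = a * s + 1] (mod q)" using as by (metis cong_sym cong_trans)
        then have "[v * s = a * s] (mod q)" by (simp only: cong_add_rcancel_nat)
        then have "[v = a] (mod q)" using cs by (simp add: cong_mult_rcancel_nat coprime_commute)
        \<comment> \<open>Integrality turns the strict gap into
          \<open>v + 1 \<le> 2 M - 2 q\<close>, just enough for
          \<open>v e < 1 / q - 1 / M\<close>.\<close>
        then have "v + 1 + 2 * q \<le> 2 * n + 2" using gap[OF v] by simp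
        then have "real (v + 1 + 2 * q) \<le> real (2 * n + 2)" by (simp only: of_nat_le_iff)
        then have "real v + 1 \<le> 2 * M - 2 * q" by (simp add: M_def)
        then have "(real v + 1) / (2 * q * M) \<le> (2 * M - 2 * q) / (2 * q * M)"
          by (rule divide_right_mono[OF _ less_imp_le[OF qM]])
        also have "\<dots> = 1 / q - 1 / M" using q M by (simp add: field_simps)
        finally have "v * e < 1 / q - 1 / M" using up by linarith
        moreover have "real b / q \<ge> 1 / q" using 3 by (intro divide_right_mono) auto
        ultimately show ?thesis using b1 e0 qn by linarith
      qed
    qed
    have "1 / M > 0" using M by simp
    then have "0 \<le> real b / q + v * e" "real b / q + v * e < 1" using main by linarith+
    then have "frac (real v * (real s / real q + e)) = real b / q + v * e"
      unfolding b_def using q by (intro frac_eq_mod_div_add)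
    moreover have "real n / (real n + 1) = 1 - 1 / M" by (simp add: field_simps M_def)
    ultimately show "1 / (real n + 1) < frac (real v * (real s / real q + e)) \<and>
       frac (real v * (real s / real q + e)) < real n / (real n + 1)" using main by (simp add: M_def)
  qed
qed

section \<open>Counting the missing speeds\<close>

text \<open>As the perturbation fails for every \<open>a\<close> coprime to \<open>q\<close>, each
  totative is the residue of some \<open>v \<ge> 2 n + 2 - 2 q\<close> in \<open>V\<close>, and
  \<open>v \<le> N\<close>.\<close>

lemma totient_le_if_not_loose:
  fixes q n N :: nat
  assumes q: "0 < q" "q \<le> n" "q \<notin> V" and V: "V \<subseteq> {0<..N}" and N: "N + 1 \<le> 2 * n"
    and nl: "\<not> loose n V"
  shows "totient q \<le> N + 1 - (2 * n + 2 - 2 * q)"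
proof -
  \<comment> \<open>Totatives lie in \<open>{1..q}\<close>, so residue 0 is represented by
    \<open>q\<close>; this matters only for \<open>q = 1\<close>.\<close>
  let ?f = "\<lambda>v. if v mod q = 0 then q else v mod q"
  have "totatives q \<subseteq> ?f ` {2 * n + 2 - 2 * q..N}"
  proof
    fix a assume a: "a \<in> totatives q"
    then have "coprime a q" by (simp add: in_totatives_iff)
    then obtain v where v: "v \<in> V" "[v = a] (mod q)" "\<not> v + 2 * q < 2 * n + 2"
      using loose_if_perturbation[OF q V N] nl by blast
    have "?f v = a"
    proof (cases "a = q")
      case True
      then show ?thesis using v(2) by (simp add: cong_def)
    next
      case False
      then have "0 < a" "a < q" using a by (auto simp: in_totatives_iff)
      then show ?thesis using v(2) by (simp add: cong_def)
    qed
    moreover have "v \<in> {2 * n + 2 - 2 * q..N}" using v V by auto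
    ultimately show "a \<in> ?f ` {2 * n + 2 - 2 * q..N}" by blast
  qed
  from surj_card_le[OF _ this] show ?thesis by (simp add: totient_def)
qed

lemma totient_ge:
  assumes "0 < q" "q \<le> 2 ^ W"
  shows "q \<le> totient q * (W + 1)"
proof -
  have "card (prime_factors q) \<le> W"
    using assms by (intro card_primes_dvd_le[of q W]) auto
  then have "1 / (real W + 1) \<le> 1 / (card (prime_factors q) + 1)"
    by (intro divide_left_mono) auto
  also have "\<dots> \<le> (\<Prod>p\<in>prime_factors q. 1 - 1 / real p)"
    by (intro prod_one_minus_inverse_ge) (auto intro: prime_ge_2_nat)
  finally have "real q * (1 / (real W + 1)) \<le> real (totient q)"
    unfolding totient_formula2 by (intro mult_left_mono) auto
  then have "real q \<le> real (totient q * (W + 1))" by (simp add: field_simps)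
  then show ?thesis by (simp only: of_nat_le_iff)
qed

text \<open>The count with explicit parameters: \<open>K\<close> full blocks hold at most
  \<open>K * (2 * m)\<close> missing numbers and at most \<open>N0 - 1 - K * (2 * m)\<close> more
  fit below \<open>N\<close>, one short of the required \<open>N0\<close>.\<close>

lemma loose_if_max_le:
  fixes k m n N W :: nat
  assumes k: "odd k" "200 * (W + 2) ^ 3 \<le> 2 ^ k" and m: "200 * (W + 2) ^ (k + 1) \<le> m" "100 * (300 * W) ^ 3 \<le> m"
    and W: "0 < W" "2 * n \<le> 2 ^ W"
    and V: "V \<subseteq> {0<..N}" "card V = n" "N \<in> V" and N: "n < N" "N + 8 * m * (W + 2) + 2 \<le> 2 * n"
  shows "loose n V"
proof (rule ccontr)
  assume nl: "\<not> loose n V"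
  have fV: "finite V" using V(1) finite_subset by blast
  have m0: "0 < m" using m(1) by (intro gr0I) auto
  define L where "L = (2 * n - N) div 2"
  define h where "h = N div 2"
  define N0 where "N0 = N - n"
  \<comment> \<open>\<open>N\<close> and \<open>2 n - N\<close> have the same parity, so
    \<open>h - L = N - n\<close> exactly.\<close>
  have hL: "h = N0 + L" "N \<le> 2 * h + 1" "2 * h \<le> N" "n \<le> h + L + 1" "h + L \<le> n"
    using N by (auto simp: L_def h_def N0_def)
  have Lbig: "4 * m * (W + 2) \<le> L" using N(2) by (simp add: L_def)
  have "4 * m * 2 \<le> 4 * m * (W + 2)" by (intro mult_le_mono2) simp
  then have Lm: "8 * m \<le> L" using Lbig by linarith
  have N1: "N + 1 \<le> 2 * n" using N(2) by linarith
  have L2: "2 * L \<le> 2 * n - N" "2 * n - N \<le> 2 * L + 1" by (simp_all add: L_def)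
  define A where "A = {0<..h} - V"
  define B where "B = {n<..N} - V"
  \<comment> \<open>Positive multiples of \<open>q\<close> other than \<open>q\<close> are at least
    \<open>2 q > N\<close>, so time \<open>1 / q\<close> applies.\<close>
  have mid: "q \<in> V" if q: "h < q" "q \<le> n" for q
  proof (rule ccontr)
    assume "q \<notin> V"
    have "\<not> q dvd v" if "v \<in> V" for v
    proof
      assume "q dvd v"
      then obtain c where c: "v = q * c" by (elim dvdE)
      have v: "0 < v" "v \<le> N" "v \<noteq> q" using that V(1) \<open>q \<notin> V\<close> by auto
      then have "c \<noteq> 0" "c \<noteq> 1" using c by auto
      then have "2 * q \<le> v" using c by simp
      then show False using q(1) v(2) by (simp add: h_def)
    qed
    then have "loose n V" using q by (intro loose_if_no_multiple) auto
    then show False using nl by simp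
  qed
  have AB: "card A + card B = N0"
  proof -
    have "{0<..N} - V = A \<union> B" "A \<inter> B = {}"
      using mid hL N by (auto simp: A_def B_def) (meson not_le)+
    then have "card ({0<..N} - V) = card A + card B"
      by (simp add: card_Un_disjoint A_def B_def)
    then show ?thesis using V fV by (simp add: card_Diff_subset N0_def)
  qed
  \<comment> \<open>Otherwise \<open>totient q < 4 m\<close>, so
    \<open>q < 4 m (W + 1) \<le> L\<close>, whereas positivity of the totient forces
    \<open>q > L\<close>. The margin \<open>2 m\<close> covers the incomplete last block.\<close>
  have lowA: "L + 2 * m < q" if q: "q \<in> A" for q
  proof (rule ccontr)
    assume "\<not> L + 2 * m < q"
    then have qL: "q \<le> L + 2 * m" by simp
    have q': "0 < q" "q \<le> n" "q \<notin> V" using q hL by (auto simp: A_def)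
    have t: "totient q \<le> N + 1 - (2 * n + 2 - 2 * q)"
      by (rule totient_le_if_not_loose[OF q' V(1) N1 nl])
    have t0: "0 < totient q" using q' by simp
    then have "L < q" using t L2 N1 q' by linarith
    moreover have "totient q * (W + 1) < 4 * m * (W + 1)"
      using t qL L2 N1 q' m0 by (intro mult_strict_right_mono) linarith+
    moreover have "q \<le> totient q * (W + 1)" using q' W(2) by (intro totient_ge) auto
    moreover have "4 * m * (W + 1) \<le> 4 * m * (W + 2)" by (intro mult_le_mono2) simp
    ultimately show False using Lbig by linarith
  qed
  have nc: "\<not> coprime x y" if "x \<in> A" "y \<in> B" "N < x + y" "x + y \<le> 2 * n + 1" for x y
  proof
    assume "coprime x y"
    then have "loose n V" using that V(1)
      by (intro loose_if_coprime_gaps[of x y]) (auto simp: A_def B_def)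
    then show False using nl by simp
  qed
  \<comment> \<open>\<open>N0 - 1\<close> appears because \<open>N\<close> lies in \<open>V\<close>:
    only \<open>N0 - 1\<close> candidates remain above \<open>n\<close>.\<close>
  define K where "K = (N0 - 1) div (2 * m)"
  have N0: "0 < N0" using N(1) by (simp add: N0_def)
  have K1: "K * (2 * m) \<le> N0 - 1" unfolding K_def by (rule div_times_less_eq_dividend)
  have K2: "N0 - 1 < K * (2 * m) + 2 * m"
    using div_mult_mod_eq[of "N0 - 1" "2 * m"] mod_less_divisor[of "2 * m" "N0 - 1"] m0
    unfolding K_def by linarith
  have blocks: "card (A \<inter> {h - j * (2 * m)<..h}) + card (B \<inter> {n<..n + j * (2 * m)}) \<le> j * (2 * m)"
    if "j \<le> K" for j
    using that
  proof (induction j)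
    case 0
    then show ?case by simp
  next
    case (Suc j)
    define d where "d = j * (2 * m)"
    have "Suc j * (2 * m) \<le> K * (2 * m)" using Suc.prems by (rule mult_le_mono1)
    then have d: "d + 2 * m \<le> N0 - 1" using K1 by (simp add: d_def)
    \<comment> \<open>The offset \<open>d\<close> cancels in \<open>x + y\<close>, which stays
      within \<open>2 m\<close> of \<open>h + n\<close>; \<open>L \<ge> 8 m\<close> keeps this in
      the admissible range.\<close>
    define S where "S = A \<inter> {h - (d + 2 * m)<..h - d}"
    define T where "T = B \<inter> {n + d<..n + (d + 2 * m)}"
    have 1: "card S + card T \<le> 2 * m"
    proof (rule non_coprime_intervals_card_le[OF k m W(1)])
      show "S \<subseteq> {h - (d + 2 * m)<..h - (d + 2 * m) + 2 * m}" using d hL by (auto simp: S_def)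
      show "T \<subseteq> {n + d<..n + d + 2 * m}" by (auto simp: T_def)
      show "h - (d + 2 * m) + 2 * m \<le> 2 ^ W" "n + d + 2 * m \<le> 2 ^ W"
        using W(2) N1 d hL by (auto simp: N0_def)
      show "\<not> coprime x y" if xy: "x \<in> S" "y \<in> T" for x y
      proof (rule nc)
        have b: "h < x + (d + 2 * m)" "x \<le> h - d" "n + d < y" "y \<le> n + (d + 2 * m)"
          using xy by (auto simp: S_def T_def)
        show "N < x + y" using b hL Lm by linarith
        show "x + y \<le> 2 * n + 1" using b hL Lm d by linarith
      qed (use xy in \<open>auto simp: S_def T_def\<close>)
    qed
    have "A \<inter> {h - (d + 2 * m)<..h} = (A \<inter> {h - d<..h}) \<union> S"
      by (auto simp: S_def)
    then have 2: "card (A \<inter> {h - (d + 2 * m)<..h}) \<le> card (A \<inter> {h - d<..h}) + card S"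
      by (metis card_Un_le)
    have "B \<inter> {n<..n + (d + 2 * m)} = (B \<inter> {n<..n + d}) \<union> T"
      by (auto simp: T_def)
    then have 3: "card (B \<inter> {n<..n + (d + 2 * m)}) \<le> card (B \<inter> {n<..n + d}) + card T"
      by (metis card_Un_le)
    have 4: "card (A \<inter> {h - d<..h}) + card (B \<inter> {n<..n + d}) \<le> d"
      unfolding d_def using Suc by simp
    have Sj: "Suc j * (2 * m) = d + 2 * m" by (simp add: d_def)
    show ?case unfolding Sj using 1 2 3 4 by linarith
  qed
  \<comment> \<open>Numbers below the \<open>K\<close> blocks are at most \<open>L + 2 m\<close>,
    where \<open>A\<close> has no elements.\<close>
  have "A \<inter> {h - K * (2 * m)<..h} = A"
  proof -
    have "h - K * (2 * m) < q" if "q \<in> A" for q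
      using lowA[OF that] K2 N0 hL(1) by linarith
    then show ?thesis by (auto simp: A_def)
  qed
  moreover have "card B \<le> card (B \<inter> {n<..n + K * (2 * m)}) + (N0 - 1 - K * (2 * m))"
  proof -
    have "B \<subseteq> (B \<inter> {n<..n + K * (2 * m)}) \<union> {n + K * (2 * m)<..<N}"
      using V(3) by (auto simp: B_def)
    then have "card B \<le> card ((B \<inter> {n<..n + K * (2 * m)}) \<union> {n + K * (2 * m)<..<N})"
      by (intro card_mono) auto
    also have "\<dots> \<le> card (B \<inter> {n<..n + K * (2 * m)}) + card {n + K * (2 * m)<..<N}"
      by (rule card_Un_le)
    finally show ?thesis by (simp add: N0_def)
  qed
  ultimately show False using blocks[of K] AB K1 N0 by simp
qed

section \<open>Choice of the sieve parameters\<close>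

text \<open>The block length is a power of \<open>W + 2\<close>, of order \<open>log n\<close>, with
  exponent of order \<open>log log n\<close>. The constant 100 is \<open>2 * 50\<close>, from
  \<open>W + 2 \<le> exp (2 l)\<close> and \<open>k + 11 \<le> 50 l\<close>.\<close>

lemma sieve_parameters_exist:
  fixes n :: nat
  assumes n: "2 \<le> n" and l: "50 \<le> ln (ln (real n))"
  obtains k m W :: nat where "odd k" "200 * (W + 2) ^ 3 \<le> 2 ^ k" "200 * (W + 2) ^ (k + 1) \<le> m"
    "100 * (300 * W) ^ 3 \<le> m" "0 < W" "2 * n \<le> 2 ^ W"
    "real (8 * m * (W + 2) + 2) \<le> exp (100 * (ln (ln (real n)))\<^sup>2)"
proof -
  define l where "l = ln (ln (real n))"
  have l50: "50 \<le> l" using assms by (simp add: l_def)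
  have lnpos: "0 < ln (real n)" using n by simp
  have expl: "exp l = ln (real n)" using lnpos by (simp add: l_def)
  have lnbig: "51 \<le> ln (real n)" using exp_ge_add_one_self[of l] l50 expl by linarith
  have ln2: "1 / 2 \<le> ln (2 :: real)" using exp_half_le2 by (subst ln_ge_iff) auto
  \<comment> \<open>Odd for the Bonferroni step; \<open>k \<ge> 20 l\<close> gives
    \<open>2 ^ k \<ge> exp (10 l)\<close>, which exceeds
    \<open>exp (4 l) * exp (2 l) ^ 3\<close>.\<close>
  define k where "k = 2 * nat \<lceil>10 * l\<rceil> + 1"
  \<comment> \<open>The 4 comes from \<open>2 n \<le> n ^ 2\<close> and
    \<open>ln 2 \<ge> 1 / 2\<close>.\<close>
  define W where "W = nat \<lceil>4 * ln (real n)\<rceil>"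
  \<comment> \<open>The 8 powers beyond \<open>k + 1\<close> absorb the factor 200; the ninth power
    alone dominates \<open>100 * (300 * W) ^ 3\<close>.\<close>
  define m where "m = (W + 2) ^ (k + 9)"
  have "real k = 2 * real_of_int \<lceil>10 * l\<rceil> + 1" using l50 by (simp add: k_def)
  then have k_lo: "20 * l \<le> real k" and k_hi: "real k \<le> 20 * l + 3" by linarith+
  have W_lo: "4 * ln (real n) \<le> real W" and W_hi: "real W \<le> 4 * ln (real n) + 1"
    using lnbig by (simp_all add: W_def)
  have W100: "100 \<le> W" using W_lo lnbig by linarith
  have "real W + 2 \<le> 4 * ln (real n) + 3" using W_hi by simp
  also have "\<dots> \<le> ln (real n) * ln (real n)"
  proof -
    have "51 * ln (real n) \<le> ln (real n) * ln (real n)" using lnbig by (intro mult_right_mono) auto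
    then show ?thesis using lnbig by linarith
  qed
  also have "\<dots> = exp (2 * l)" by (simp add: expl[symmetric] exp_add[symmetric])
  finally have W2: "real W + 2 \<le> exp (2 * l)" .
  show thesis
  proof (rule that)
    show "odd k" by (simp add: k_def)
    show "0 < W" using W100 by simp
    show "2 * n \<le> 2 ^ W"
    proof -
      have "2 * real n \<le> real n * real n" using n by (intro mult_right_mono) auto
      also have "\<dots> = exp (2 * ln (real n))" using n by (simp only: mult_2 exp_add) simp
      also have "\<dots> \<le> exp (real W * ln 2)"
      proof -
        have "2 * ln (real n) \<le> real W * (1 / 2)" using W_lo lnpos by linarith
        also have "\<dots> \<le> real W * ln 2" by (intro mult_left_mono ln2) auto
        finally show ?thesis by simp
      qed
      also have "\<dots> = 2 ^ W" by (simp only: exp_of_nat_mult) simp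
      finally have "real (2 * n) \<le> real (2 ^ W)" by simp
      then show ?thesis by (simp only: of_nat_le_iff)
    qed
    show "200 * (W + 2) ^ 3 \<le> 2 ^ k"
    proof -
      have "200 \<le> exp (4 * l)" using exp_ge_add_one_self[of "4 * l"] l50 by linarith
      then have "200 * (real W + 2) ^ 3 \<le> exp (4 * l) * exp (2 * l) ^ 3"
        using W2 by (intro mult_mono power_mono) auto
      also have "\<dots> = exp (10 * l)"
      proof -
        have "exp (2 * l) ^ 3 = exp (of_nat 3 * (2 * l))" by (simp only: exp_of_nat_mult)
        then show ?thesis by (simp add: mult_exp_exp)
      qed
      also have "\<dots> \<le> exp (real k * ln 2)"
      proof -
        have "10 * l \<le> real k * (1 / 2)" using k_lo l50 by linarith
        also have "\<dots> \<le> real k * ln 2" by (intro mult_left_mono ln2) auto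
        finally show ?thesis by simp
      qed
      also have "\<dots> = 2 ^ k" by (simp only: exp_of_nat_mult) simp
      finally have "real (200 * (W + 2) ^ 3) \<le> real (2 ^ k)" by (simp add: add.commute)
      then show ?thesis by (simp only: of_nat_le_iff)
    qed
    show "200 * (W + 2) ^ (k + 1) \<le> m"
    proof -
      have "2 ^ 8 \<le> (W + 2) ^ 8" by (intro power_mono) auto
      then have "200 * (W + 2) ^ (k + 1) \<le> (W + 2) ^ 8 * (W + 2) ^ (k + 1)"
        by (intro mult_right_mono) auto
      also have "\<dots> = (W + 2) ^ (8 + (k + 1))" by (rule power_add[symmetric])
      also have "8 + (k + 1) = k + 9" by simp
      also have "(W + 2) ^ (k + 9) = m" by (simp only: m_def)
      finally show ?thesis .
    qed
    show "100 * (300 * W) ^ 3 \<le> m"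
    proof -
      have "100 * (300 * W) ^ 3 = 2700000000 * W ^ 3" by (simp add: power_mult_distrib)
      also have "\<dots> \<le> (W + 2) ^ 6 * (W + 2) ^ 3"
      proof (intro mult_mono power_mono)
        have "100 ^ 6 \<le> (W + 2) ^ 6" using W100 by (intro power_mono) auto
        then show "2700000000 \<le> (W + 2) ^ 6" by simp
      qed auto
      also have "\<dots> = (W + 2) ^ 9" using power_add[of "W + 2" 6 3] by simp
      also have "\<dots> \<le> m" unfolding m_def by (intro power_increasing) auto
      finally show ?thesis .
    qed
    show "real (8 * m * (W + 2) + 2) \<le> exp (100 * (ln (ln (real n)))\<^sup>2)"
    proof -
      have "0 < m * (W + 2)" by (simp add: m_def)
      then have "8 * m * (W + 2) + 2 \<le> 10 * (m * (W + 2))" unfolding mult.assoc by linarith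
      also have "\<dots> \<le> (W + 2) * (m * (W + 2))" using W100 by (intro mult_right_mono) auto
      also have "\<dots> = (W + 2) ^ (k + 11)"
      proof -
        have "(W + 2) * (m * (W + 2)) = (W + 2) ^ (k + 9) * (W + 2) ^ 2"
          by (simp only: m_def power2_eq_square mult_ac)
        also have "\<dots> = (W + 2) ^ (k + 9 + 2)" by (rule power_add[symmetric])
        also have "k + 9 + 2 = k + 11" by simp
        finally show ?thesis .
      qed
      finally have "real (8 * m * (W + 2) + 2) \<le> real ((W + 2) ^ (k + 11))" by (simp only: of_nat_le_iff)
      also have "\<dots> = (real W + 2) ^ (k + 11)" by (simp only: of_nat_power of_nat_add of_nat_numeral)
      also have "\<dots> \<le> exp (2 * l) ^ (k + 11)" using W2 by (intro power_mono) auto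
      also have "\<dots> = exp (real (k + 11) * (2 * l))" by (simp only: exp_of_nat_mult)
      also have "\<dots> \<le> exp (100 * l\<^sup>2)"
      proof -
        have "real (k + 11) \<le> 50 * l" using k_hi l50 by simp
        then have "real (k + 11) * (2 * l) \<le> 50 * l * (2 * l)" using l50 by (intro mult_right_mono) auto
        also have "\<dots> = 100 * l\<^sup>2" by (simp add: power2_eq_square)
        finally show ?thesis by simp
      qed
      finally show ?thesis by (simp add: l_def)
    qed
  qed
qed

theorem theorem1p3:
  shows "\<exists>C::real. \<forall>\<^sub>F n::nat in sequentially.
    \<forall>v :: nat \<Rightarrow> nat.
      strict_mono_on {1..n} v \<longrightarrow>
      (\<forall>i\<in>{1..n}. 0 < v i) \<longrightarrow>
      n < v n \<longrightarrow>
      real (v n) \<le> 2 * real n - exp (C * (ln (ln (real n)))\<^sup>2) \<longrightarrow>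
      (\<exists>t::real. \<forall>i\<in>{1..n}.
         1 / (real n + 1) < frac (real (v i) * t) \<and>
         frac (real (v i) * t) < real n / (real n + 1))"
proof (rule exI[of _ 100])
  have "\<forall>\<^sub>F n::nat in sequentially. 50 \<le> ln (ln (real n))" by real_asymp
  moreover have "\<forall>\<^sub>F n::nat in sequentially. 2 \<le> n" by (rule eventually_ge_at_top)
  ultimately show "\<forall>\<^sub>F n::nat in sequentially.
    \<forall>v :: nat \<Rightarrow> nat.
      strict_mono_on {1..n} v \<longrightarrow>
      (\<forall>i\<in>{1..n}. 0 < v i) \<longrightarrow>
      n < v n \<longrightarrow>
      real (v n) \<le> 2 * real n - exp (100 * (ln (ln (real n)))\<^sup>2) \<longrightarrow>
      (\<exists>t::real. \<forall>i\<in>{1..n}.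
         1 / (real n + 1) < frac (real (v i) * t) \<and>
         frac (real (v i) * t) < real n / (real n + 1))"
  proof eventually_elim
    case (elim n)
    show ?case
    proof (intro allI impI)
      fix v :: "nat \<Rightarrow> nat"
      assume mono: "strict_mono_on {1..n} v" and pos: "\<forall>i\<in>{1..n}. 0 < v i"
        and lt: "n < v n" and le: "real (v n) \<le> 2 * real n - exp (100 * (ln (ln (real n)))\<^sup>2)"
      obtain k m W where par: "odd k" "200 * (W + 2) ^ 3 \<le> 2 ^ k" "200 * (W + 2) ^ (k + 1) \<le> m"
          "100 * (300 * W) ^ 3 \<le> m" "0 < W" "2 * n \<le> 2 ^ W"
        and size: "real (8 * m * (W + 2) + 2) \<le> exp (100 * (ln (ln (real n)))\<^sup>2)"
        using elim by (elim sieve_parameters_exist)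
      have "v i \<le> v n" if "i \<in> {1..n}" for i
        using strict_mono_on_leD[OF mono that, of n] that elim by auto
      then have "v ` {1..n} \<subseteq> {0<..v n}" using pos by auto
      moreover have "card (v ` {1..n}) = n"
        using strict_mono_on_imp_inj_on[OF mono] by (simp add: card_image)
      moreover have "v n \<in> v ` {1..n}" using elim by auto
      moreover have "real (v n + 8 * m * (W + 2) + 2) \<le> real (2 * n)" using size le by simp
      then have "v n + 8 * m * (W + 2) + 2 \<le> 2 * n" by (simp only: of_nat_le_iff)
      ultimately have "loose n (v ` {1..n})"
        by (intro loose_if_max_le[OF par _ _ _ lt])
      then show "\<exists>t::real. \<forall>i\<in>{1..n}.
         1 / (real n + 1) < frac (real (v i) * t) \<and>
         frac (real (v i) * t) < real n / (real n + 1)" by (auto simp: loose_def)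
    qed
  qed
qed

end
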